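(* Let $w\in\mathcal S_n$ and $1\le q<n$. Then $$\mathcal G_w(x_1,\dots,x_{q-1},\,y,\,x_q,\dots,x_{n-1})=\sum_{j\ge 0,\ u\in\mathcal S_n}c^{\,\xi_{q,j}(u)}_{w,\ r_{[q,n-q+1]}}\ y^j\,\mathcal G_u(x).$$ If $q=1$, then this simplifies to $$\mathcal G_w(y,x_1,\dots,x_{n-1})=\sum_{j\ge 0,\ u\in\mathcal S_{n-1}}c^{\,(n+j).u}_{w,\ r_{[1,n-1]}}\ y^j\,\mathcal G_u(x).$$
   Context: Permutations are written in one-line notation, products are compositions $(uv)(i)=u(v(i))$, $s_i$ is the transposition of $i,i+1$, $\omega_n=[n,\dots,2,1]$, and $\mathcal S_\infty=\bigcup_n\mathcal S_n$. Grothendieck polynomials: $s_i$ acts on $\mathbb Z[x_1,\dots,x_n]$ by exchanging $x_i,x_{i+1}$. Let $\pi_i f=\dfrac{(1-x_{i+1})f-s_i((1-x_{i+1})f)}{x_i-x_{i+1}}$ and $\pi_v=\pi_{i_1}\cdots\pi_{i_r}$ for any reduced word $v=s_{i_1}\cdots s_{i_r}$. Put $\mathcal G_{\omega_n}=x_1^{n-1}x_2^{n-2}\cdots x_{n-1}$ and $\mathcal G_w=\pi_{w^{-1}\omega_n}\mathcal G_{\omega_n}$ for $w\in\mathcal S_n$; $\mathcal G_w$ does not depend on the choice of $n$ with $w\in\mathcal S_n$, and $\{\mathcal G_w\mid w\in\mathcal S_\infty\}$ is a $\mathbb Z$-basis of $\mathbb Z[x_1,x_2,\dots]$. The Schubert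 structure constants $c^w_{u,v}\in\mathbb Z$ are defined by $\mathcal G_u\cdot\mathcal G_v=\sum_{w\in\mathcal S_\infty}c^w_{u,v}\,\mathcal G_w$. For positive integers $k,p$, $r_{[k,p]}\in\mathcal S_\infty$ is $[1,\dots,k-1,k+p,k,k+1,\dots,\widehat{k+p},\dots]=s_{k+p-1}s_{k+p-2}\cdots s_k$. For $u\in\mathcal S_n$ and $j\ge 0$, $\xi_{q,j}(u)\in\mathcal S_\infty$ is the permutation whose first $n+1$ values are $u_1,\dots,u_{q-1},\,n+j+1,\,u_q,\dots,u_n$ and whose remaining values are increasing. For $u\in\mathcal S_{n-1}$ and $j\ge0$, $(n+j).u\in\mathcal S_\infty$ is the permutation whose first $n$ values are $n+j,u_1,\dots,u_{n-1}$ and whose remaining values are increasing. *)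

theory Defs
  imports
    "HOL-Library.Poly_Mapping"
    "HOL-Computational_Algebra.Polynomial"
    "HOL-Combinatorics.Combinatorics"
begin

section \<open>Permutations\<close>

text \<open>
  A permutation is a function \<open>nat \<Rightarrow> nat\<close>; the one-line notation \<open>[w\<^sub>1, w\<^sub>2, \<dots>]\<close> stands for
  \<open>w 1, w 2, \<dots>\<close>. Elements of \<open>Sym n\<close> fix \<open>0\<close> and everything above \<open>n\<close>, so that
  \<open>Sym n \<subseteq> Sym (Suc n)\<close> literally, and the product \<open>uv\<close> is \<open>u \<circ> v\<close>.
\<close>

definition Sym :: "nat \<Rightarrow> (nat \<Rightarrow> nat) set" where
  "Sym n = {w. w permutes {1..n}}"

definition Sym_inf :: "(nat \<Rightarrow> nat) set" where
  "Sym_inf = (\<Union>n. Sym n)"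

definition longest :: "nat \<Rightarrow> nat \<Rightarrow> nat" where
  "longest n i = (if 1 \<le> i \<and> i \<le> n then n + 1 - i else i)"

definition word_perm :: "nat list \<Rightarrow> nat \<Rightarrow> nat" where
  "word_perm is = foldr (\<lambda>i v. transpose i (Suc i) \<circ> v) is id"

definition reduced_word :: "(nat \<Rightarrow> nat) \<Rightarrow> nat list \<Rightarrow> bool" where
  "reduced_word v is \<longleftrightarrow>
     is_arg_min length (\<lambda>js. set js \<subseteq> {1..} \<and> word_perm js = v) is"

text \<open>The permutation with the given first values whose remaining values are increasing.\<close>

definition increasing_completion :: "nat list \<Rightarrow> nat \<Rightarrow> nat" where
  "increasing_completion xs =
     (THE w. w \<in> Sym_inf \<and> map w [1..<length xs + 1] = xs \<and> strict_mono_on {length xs<..} w)"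

text \<open>\<open>r\<^bsub>[k,p]\<^esub> = s\<^bsub>k+p-1\<^esub> \<cdots> s\<^bsub>k\<^esub>\<close>\<close>

definition r_perm :: "nat \<Rightarrow> nat \<Rightarrow> nat \<Rightarrow> nat" where
  "r_perm k p = word_perm (rev [k..<k + p])"

text \<open>\<open>xi n q j u\<close> is \<open>\<xi>\<^bsub>q,j\<^esub>(u)\<close> for \<open>u \<in> Sym n\<close>; it depends on the \<open>n\<close> for which \<open>u\<close> is regarded
  as an element of \<open>Sym n\<close>.\<close>

definition xi :: "nat \<Rightarrow> nat \<Rightarrow> nat \<Rightarrow> (nat \<Rightarrow> nat) \<Rightarrow> nat \<Rightarrow> nat" where
  "xi n q j u = increasing_completion (map u [1..<q] @ [n + j + 1] @ map u [q..<n + 1])"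

text \<open>\<open>prepend n j u\<close> is \<open>(n+j).u\<close> for \<open>u \<in> Sym (n - 1)\<close>.\<close>

definition prepend :: "nat \<Rightarrow> nat \<Rightarrow> (nat \<Rightarrow> nat) \<Rightarrow> nat \<Rightarrow> nat" where
  "prepend n j u = increasing_completion ((n + j) # map u [1..<n])"

section \<open>Grothendieck polynomials\<close>

text \<open>
  Polynomials over \<open>\<int>\<close> are finitely supported maps from exponent vectors to coefficients.
  The variables of interest are \<open>x\<^sub>1, x\<^sub>2, \<dots>\<close>; the type also contains a variable with index \<open>0\<close>,
  which is never used.
\<close>

type_synonym zpoly = "(nat \<Rightarrow>\<^sub>0 nat) \<Rightarrow>\<^sub>0 int"

definition Var :: "nat \<Rightarrow> zpoly" where
  "Var i = Poly_Mapping.single (Poly_Mapping.single i 1) 1"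

definition substitute :: "(nat \<Rightarrow> 'a::comm_ring_1) \<Rightarrow> zpoly \<Rightarrow> 'a" where
  "substitute f p =
     (\<Sum>m\<in>Poly_Mapping.keys p. of_int (Poly_Mapping.lookup p m) *
        (\<Prod>i\<in>Poly_Mapping.keys m. f i ^ Poly_Mapping.lookup m i))"

definition s_act :: "nat \<Rightarrow> zpoly \<Rightarrow> zpoly" where
  "s_act i = substitute (\<lambda>j. Var (transpose i (Suc i) j))"

definition demazure :: "nat \<Rightarrow> zpoly \<Rightarrow> zpoly" where
  "demazure i f =
     (THE g. (Var i - Var (Suc i)) * g =
             (1 - Var (Suc i)) * f - s_act i ((1 - Var (Suc i)) * f))"

text \<open>The operators \<open>demazure i\<close> satisfy the braid relations, so the chosen reduced word does
  not matter.\<close>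

definition demazure_perm :: "(nat \<Rightarrow> nat) \<Rightarrow> zpoly \<Rightarrow> zpoly" where
  "demazure_perm v f = foldr demazure (SOME is. reduced_word v is) f"

definition groth_in :: "nat \<Rightarrow> (nat \<Rightarrow> nat) \<Rightarrow> zpoly" where
  "groth_in n w = demazure_perm (inv w \<circ> longest n) (\<Prod>i=1..n. Var i ^ (n - i))"

text \<open>\<open>groth_in n w\<close> is the same for all \<open>n\<close> with \<open>w \<in> Sym n\<close>; the least such \<open>n\<close> is used.\<close>

definition groth :: "(nat \<Rightarrow> nat) \<Rightarrow> zpoly" where
  "groth w = groth_in (LEAST n. w \<in> Sym n) w"

text \<open>\<open>struct_const u v w\<close> is \<open>c\<^sup>w\<^bsub>u,v\<^esub>\<close>. The finitely supported coefficient family is unique because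
  the Grothendieck polynomials form a basis.\<close>

definition struct_const :: "(nat \<Rightarrow> nat) \<Rightarrow> (nat \<Rightarrow> nat) \<Rightarrow> (nat \<Rightarrow> nat) \<Rightarrow> int" where
  "struct_const u v = Poly_Mapping.lookup
     (THE c :: (nat \<Rightarrow> nat) \<Rightarrow>\<^sub>0 int. Poly_Mapping.keys c \<subseteq> Sym_inf \<and>
        groth u * groth v =
          (\<Sum>w\<in>Poly_Mapping.keys c. of_int (Poly_Mapping.lookup c w) * groth w))"

section \<open>Inserting a new variable\<close>

text \<open>The ring \<open>\<int>[x\<^sub>1, x\<^sub>2, \<dots>][y]\<close> is \<open>zpoly poly\<close>.\<close>

definition Y :: "zpoly poly" where
  "Y = [:0, 1:]"

text \<open>\<open>insert_var q f\<close> is \<open>f(x\<^sub>1, \<dots>, x\<^bsub>q-1\<^esub>, y, x\<^sub>q, x\<^bsub>q+1\<^esub>, \<dots>)\<close>.\<close>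

definition insert_var :: "nat \<Rightarrow> zpoly \<Rightarrow> zpoly poly" where
  "insert_var q =
     substitute (\<lambda>i. if i < q then [:Var i:] else if i = q then Y else [:Var (i - 1):])"

end

theory Submission
  imports Defs
begin

text \<open>
  Write \<open>\<pi>\<^sub>i\<close> for \<open>demazure i\<close>, \<open>\<partial>\<^sub>i f = (f - s\<^sub>i f) / (x\<^sub>i - x\<^bsub>i+1\<^esub>)\<close> and
  \<open>h\<^sub>i = \<pi>\<^sub>i - 1 = (1 - x\<^sub>i) \<partial>\<^sub>i\<close>
  (below, \<open>\<partial>\<^sub>i\<close> is \<open>ddiff i\<close> and \<open>h\<^sub>i\<close> is \<open>hat i\<close>). The operator \<open>\<pi>\<^sub>i\<close> sends \<open>G\<^sub>w\<close> to \<open>G\<^bsub>w s_i\<^esub>\<close> if \<open>i\<close> is a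
  descent of \<open>w\<close> and fixes it otherwise. Therefore the coordinates with respect to the basis of
  Grothendieck polynomials are computed by operators: if \<open>v = s\<^bsub>i_1\<^esub> \<cdots> s\<^bsub>i_r\<^esub>\<close> is reduced, the
  coefficient of \<open>G\<^sub>v\<close> in \<open>f\<close> is the constant term of \<open>h\<^bsub>i_1\<^esub> \<cdots> h\<^bsub>i_r\<^esub> f\<close>
  (\<open>const_term_hat_groth\<close>, \<open>struct_const_eq\<close>).

  Let \<open>u \<in> S\<^sub>N\<close>. Since \<open>\<xi>\<^bsub>q,j\<^esub>(u) = u s\<^bsub>N+j\<^esub> \<cdots> s\<^sub>q\<close> with lengths adding up, the structure constant in
  question is the \<open>u\<close>-coordinate of \<open>h\<^bsub>N+j\<^esub> \<cdots> h\<^sub>q (G\<^sub>w G\<^sub>r)\<close>. Put \<open>m = N + j + 1\<close>. Then this polynomial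
  equals \<open>\<Prod>\<^bsub>q\<le>i<m\<^esub> (1 - x\<^sub>i)\<close> times \<open>\<partial>\<^bsub>m-1\<^esub> \<cdots> \<partial>\<^sub>q (G\<^sub>w G\<^sub>r)\<close>, and three facts evaluate it.

  First, iterated divided differences are division with remainder. Let \<open>F(t)\<close> arise from \<open>G\<^sub>w\<close> by
  inserting \<open>t\<close> at position \<open>q\<close>, and write \<open>G\<^sub>r = D(x\<^sub>q)\<close> where \<open>D(t)\<close> has coefficients in
  \<open>\<int>[x\<^sub>1, \<dots>, x\<^bsub>q-1\<^esub>]\<close>. Then \<open>\<partial>\<^bsub>m-1\<^esub> \<cdots> \<partial>\<^sub>q (G\<^sub>w G\<^sub>r)\<close> is the value at \<open>t = x\<^sub>m\<close> of the quotient of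
  \<open>F(t) D(t)\<close> by \<open>\<Prod>\<^bsub>q\<le>i<m\<^esub> (t - x\<^sub>i)\<close> (\<open>ddiff_chain_insert\<close>); the exponent of \<open>x\<^sub>i\<close> in \<open>G\<^sub>w\<close> is at most
  \<open>n - i\<close>, and this kills all cross terms of the Leibniz rule.

  Secondly, the \<open>u\<close>-coordinates with \<open>u \<in> S\<^sub>N\<close> do not change modulo an ideal that contains \<open>x\<^sub>l\<close> for
  \<open>l > N\<close> and all symmetric polynomials in \<open>x\<^sub>1, \<dots>, x\<^sub>N\<close> without constant term; so one may compute in
  the Grothendieck ring of the flag variety. There \<open>\<Prod>\<^bsub>i\<le>N\<^esub> (t - x\<^sub>i) = t\<^sup>N\<close>, and hence
  \<open>D(t) = \<Prod>\<^bsub>i<q\<^esub> (1 - x\<^sub>i) \<Prod>\<^bsub>q\<le>i\<le>N\<^esub> (t - x\<^sub>i)\<close> (\<open>row_poly_flag\<close>). Division by the first \<open>N - q + 1\<close>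
  linear factors leaves \<open>\<Prod>\<^bsub>i<q\<^esub> (1 - x\<^sub>i) F(t)\<close>. The other \<open>j\<close> divisors are \<open>t\<close>, and \<open>x\<^sub>m\<close> is \<open>0\<close>, so what
  remains is the coefficient of \<open>t\<^sup>j\<close> in \<open>F(t)\<close>, multiplied by \<open>\<Prod>\<^bsub>i<m\<^esub> (1 - x\<^sub>i) = 1\<close>. Thus the
  structure constant is the \<open>u\<close>-coordinate of that coefficient (\<open>const_term_hat_insert\<close>).

  Thirdly, the coefficients of \<open>F(t)\<close> again satisfy staircase bounds on their exponents, so they are
  combinations of the \<open>G\<^sub>u\<close> with \<open>u \<in> S\<^sub>N\<close> only (\<open>groth_expansion\<close>). The two formulas of the theorem
  are the cases \<open>N = n\<close> and, for \<open>q = 1\<close>, \<open>N = n - 1\<close>.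

  What has to be built for this is the independence of \<open>\<pi>\<^sub>v\<close> of the reduced word (Matsumoto's theorem),
  the stability of \<open>G\<^sub>w\<close> in \<open>n\<close>, and the basis property. Spanning is obtained by showing that the span
  of the \<open>G\<^sub>w\<close> is closed under multiplication by variables (\<open>Var_mult_groth_span\<close>).
\<close>

section \<open>Polynomials and substitution\<close>

text \<open>
  Substitutions, the action of \<open>s\<^sub>i\<close>, the constant term and coefficientwise
  extensions of these maps all occur below, and share this interface.
\<close>

locale comm_ring_hom =
  fixes h :: "'a::comm_ring_1 \<Rightarrow> 'b::comm_ring_1"
  assumes hom_one [simp]: "h 1 = 1"
    and hom_add [simp]: "h (x + y) = h x + h y"
    and hom_mult [simp]: "h (x * y) = h x * h y"
begin

lemma hom_zero [simp]: "h 0 = 0"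
  using hom_add[of 0 0] by simp

lemma hom_uminus [simp]: "h (- x) = - h x"
  using hom_add[of x "- x"] by (simp add: eq_neg_iff_add_eq_0 add.commute)

lemma hom_minus [simp]: "h (x - y) = h x - h y"
  using hom_add[of x "- y"] by simp

lemma hom_sum: "h (sum f A) = (\<Sum>x\<in>A. h (f x))"
  by (induction A rule: infinite_finite_induct) auto

lemma hom_prod: "h (prod f A) = (\<Prod>x\<in>A. h (f x))"
  by (induction A rule: infinite_finite_induct) auto

lemma hom_power [simp]: "h (x ^ n) = h x ^ n"
  by (induction n) auto

lemma hom_of_nat: "h (of_nat n) = of_nat n"
  by (induction n) auto

lemma hom_of_int [simp]: "h (of_int k) = of_int k"
  by (cases k) (auto simp: hom_of_nat)

lemma map_poly_hom: "comm_ring_hom (map_poly h)"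
proof
  show "map_poly h (p * q) = map_poly h p * map_poly h q" for p q
    by (rule poly_eqI) (simp add: coeff_map_poly coeff_mult hom_sum)
  show "map_poly h (p + q) = map_poly h p + map_poly h q" for p q
    by (rule poly_eqI) (simp add: coeff_map_poly)
qed simp

lemma hom_poly: "h (poly p x) = poly (map_poly h p) (h x)"
  by (induction p) (auto simp: map_poly_pCons)

end

lemma comm_ring_hom_comp:
  assumes "comm_ring_hom g" "comm_ring_hom h"
  shows "comm_ring_hom (\<lambda>x. g (h x))"
  using assms by (simp add: comm_ring_hom_def)

lemma comm_ring_hom_id: "comm_ring_hom (\<lambda>x. x)"
  by (simp add: comm_ring_hom_def)

lemma comm_ring_hom_const_poly: "comm_ring_hom (\<lambda>c. [:c:])"
  by unfold_locales (auto simp: one_pCons)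

abbreviation monomial :: "(nat \<Rightarrow>\<^sub>0 nat) \<Rightarrow> zpoly" where
  "monomial m \<equiv> Poly_Mapping.single m 1"

lemma monomial_add: "monomial (m + m') = monomial m * monomial m'"
  by (simp add: mult_single)

lemma Var_power: "Var i ^ k = monomial (Poly_Mapping.single i k)"
  by (induction k) (auto simp: Var_def mult_single single_add[symmetric])

lemma of_int_zpoly: "(of_int c :: zpoly) = Poly_Mapping.single 0 c"
  by (metis of_int_eq_id id_apply single_of_int)

lemma zpoly_expansion:
  fixes p :: zpoly
  assumes "finite A" "Poly_Mapping.keys p \<subseteq> A"
  shows "p = (\<Sum>m\<in>A. of_int (Poly_Mapping.lookup p m) * monomial m)"
proof (rule poly_mapping_eqI)
  fix m
  have "Poly_Mapping.lookup (\<Sum>m\<in>A. of_int (Poly_Mapping.lookup p m) * monomial m) m =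
        (\<Sum>m'\<in>A. if m' = m then Poly_Mapping.lookup p m else 0)"
    unfolding lookup_sum of_int_zpoly mult_single
    by (intro sum.cong) (auto simp: lookup_single when_def)
  also have "\<dots> = Poly_Mapping.lookup p m"
    using assms by (auto simp: in_keys_iff)
  finally show "Poly_Mapping.lookup p m =
      Poly_Mapping.lookup (\<Sum>m\<in>A. of_int (Poly_Mapping.lookup p m) * monomial m) m" ..
qed

definition monomial_value :: "(nat \<Rightarrow> 'a::comm_ring_1) \<Rightarrow> (nat \<Rightarrow>\<^sub>0 nat) \<Rightarrow> 'a" where
  "monomial_value f m = (\<Prod>i\<in>Poly_Mapping.keys m. f i ^ Poly_Mapping.lookup m i)"

lemma monomial_value_superset:
  assumes "finite A" "Poly_Mapping.keys m \<subseteq> A"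
  shows "monomial_value f m = (\<Prod>i\<in>A. f i ^ Poly_Mapping.lookup m i)"
  unfolding monomial_value_def using assms
  by (intro prod.mono_neutral_left) (auto simp: in_keys_iff)

lemma monomial_value_add: "monomial_value f (m + m') = monomial_value f m * monomial_value f m'"
proof -
  let ?A = "Poly_Mapping.keys m \<union> Poly_Mapping.keys m'"
  have "monomial_value f (m + m') = (\<Prod>i\<in>?A. f i ^ Poly_Mapping.lookup (m + m') i)"
    using keys_add[of m m'] by (intro monomial_value_superset) auto
  also have "\<dots> = (\<Prod>i\<in>?A. f i ^ Poly_Mapping.lookup m i) * (\<Prod>i\<in>?A. f i ^ Poly_Mapping.lookup m' i)"
    by (simp add: lookup_add power_add prod.distrib)
  also have "\<dots> = monomial_value f m * monomial_value f m'"
    by (simp add: monomial_value_superset[of ?A])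
  finally show ?thesis .
qed

lemma substitute_superset:
  assumes "finite A" "Poly_Mapping.keys p \<subseteq> A"
  shows "substitute f p = (\<Sum>m\<in>A. of_int (Poly_Mapping.lookup p m) * monomial_value f m)"
  unfolding substitute_def monomial_value_def[symmetric] using assms
  by (intro sum.mono_neutral_left) (auto simp: in_keys_iff)

lemma substitute_monomial [simp]: "substitute f (monomial m) = monomial_value f m"
  by (subst substitute_superset[of "{m}"]) auto

lemma substitute_add [simp]: "substitute f (p + q) = substitute f p + substitute f q"
proof -
  let ?A = "Poly_Mapping.keys p \<union> Poly_Mapping.keys q"
  have "substitute f (p + q) = (\<Sum>m\<in>?A. of_int (Poly_Mapping.lookup (p + q) m) * monomial_value f m)"
    using keys_add[of p q] by (intro substitute_superset) auto
  then show ?thesis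
    by (simp add: substitute_superset[of ?A] lookup_add ring_distribs sum.distrib)
qed

lemma substitute_sum: "substitute f (sum g A) = (\<Sum>x\<in>A. substitute f (g x))"
proof -
  have "substitute f 0 = 0" by (simp add: substitute_def)
  then show ?thesis by (induction A rule: infinite_finite_induct) auto
qed

lemma substitute_scale: "substitute f (of_int c * monomial m) = of_int c * monomial_value f m"
  by (subst substitute_superset[of "{m}"]) (auto simp: of_int_zpoly mult_single simp del: single_of_int)

lemma substitute_mult: "substitute f (p * q) = substitute f p * substitute f q"
proof -
  let ?a = "\<lambda>m. of_int (Poly_Mapping.lookup p m) * monomial m :: zpoly"
  let ?b = "\<lambda>m. of_int (Poly_Mapping.lookup q m) * monomial m :: zpoly"
  have ab: "substitute f (?a m * ?b m') = substitute f (?a m) * substitute f (?b m')" for m m'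
  proof -
    have "?a m * ?b m' =
      of_int (Poly_Mapping.lookup p m * Poly_Mapping.lookup q m') * monomial (m + m')"
      by (simp only: monomial_add of_int_mult mult_ac)
    then show ?thesis
      by (simp only: substitute_scale monomial_value_add) (simp add: mult_ac)
  qed
  have p: "p = sum ?a (Poly_Mapping.keys p)" and q: "q = sum ?b (Poly_Mapping.keys q)"
    by (rule zpoly_expansion; simp)+
  have "substitute f (sum ?a (Poly_Mapping.keys p) * sum ?b (Poly_Mapping.keys q)) =
      substitute f (sum ?a (Poly_Mapping.keys p)) * substitute f (sum ?b (Poly_Mapping.keys q))"
    by (simp only: sum_product substitute_sum ab)
  then show ?thesis using p q by simp
qed

interpretation substitute: comm_ring_hom "substitute f" for f
  by unfold_locales (auto simp: substitute_mult, simp add: substitute_def)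

lemma substitute_Var [simp]: "substitute f (Var i) = f i"
  by (subst substitute_superset[of "{Poly_Mapping.single i 1}"])
     (auto simp: Var_def monomial_value_def)

lemma monomial_value_Var: "monomial_value Var m = monomial m"
proof (induction m rule: update_induct)
  case const then show ?case by (simp add: monomial_value_def)
next
  case (update m k v)
  have "Poly_Mapping.update k v m = m + Poly_Mapping.single k v"
    using update(1) by (intro poly_mapping_eqI)
      (auto simp: lookup_update lookup_add lookup_single in_keys_iff when_def)
  moreover have "monomial_value Var (Poly_Mapping.single k v) = monomial (Poly_Mapping.single k v)"
    using update(2) by (simp add: monomial_value_def Var_power)
  ultimately show ?case using update(3) by (simp add: monomial_value_add monomial_add)
qed

lemma hom_eq_substitute:
  assumes "comm_ring_hom h"
  shows "h p = substitute (\<lambda>i. h (Var i)) p"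
proof -
  interpret h: comm_ring_hom h by fact
  have m: "h (monomial m) = monomial_value (\<lambda>i. h (Var i)) m" for m
    by (subst monomial_value_Var[symmetric]) (simp add: monomial_value_def h.hom_prod)
  have "h p = h (\<Sum>m\<in>Poly_Mapping.keys p. of_int (Poly_Mapping.lookup p m) * monomial m)"
    using zpoly_expansion[of "Poly_Mapping.keys p" p] by simp
  also have "\<dots> = substitute (\<lambda>i. h (Var i)) p"
    by (simp add: h.hom_sum m substitute_def monomial_value_def[symmetric])
  finally show ?thesis .
qed

text \<open>
  Identities between composed substitutions, such as the braid relations for the
  \<open>s\<^sub>i\<close>, reduce by this to a finite check of indices.
\<close>

lemma hom_eqI:
  assumes "comm_ring_hom g" "comm_ring_hom h" "\<And>i. g (Var i) = h (Var i)"
  shows "g p = h p"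
  using hom_eq_substitute[OF assms(1), of p] hom_eq_substitute[OF assms(2), of p] assms(3)
  by simp

lemma substitute_cong:
  assumes "\<And>m i. m \<in> Poly_Mapping.keys p \<Longrightarrow> i \<in> Poly_Mapping.keys m \<Longrightarrow> f i = g i"
  shows "substitute f p = substitute g p"
  unfolding substitute_def using assms by (intro sum.cong arg_cong2[where f = "(*)"] prod.cong) auto

lemma Var_inj [simp]: "Var i = Var j \<longleftrightarrow> i = j"
proof
  assume "Var i = Var j"
  then have "Poly_Mapping.keys (Var i) = Poly_Mapping.keys (Var j)" by simp
  then have "Poly_Mapping.single i (1::nat) = Poly_Mapping.single j 1" by (simp add: Var_def)
  then have "Poly_Mapping.keys (Poly_Mapping.single i (1::nat)) = Poly_Mapping.keys (Poly_Mapping.single j (1::nat))"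
    by (simp only:)
  then show "i = j" by simp
qed simp

lemma Var_diff_cancel: "i \<noteq> j \<Longrightarrow> (Var i - Var j) * f = (Var i - Var j) * g \<Longrightarrow> f = g"
  by simp

section \<open>Divided differences\<close>

interpretation s_act: comm_ring_hom "s_act i" for i
  unfolding s_act_def by (rule substitute.comm_ring_hom_axioms)

lemma s_act_Var [simp]: "s_act i (Var j) = Var (transpose i (Suc i) j)"
  by (simp add: s_act_def)

lemma comm_ring_hom_s_act: "comm_ring_hom h \<Longrightarrow> comm_ring_hom (\<lambda>x. s_act i (h x))"
  by (rule comm_ring_hom_comp[OF s_act.comm_ring_hom_axioms])

lemma s_act_s_act [simp]: "s_act i (s_act i f) = f"
  by (rule hom_eqI) (auto intro!: comm_ring_hom_s_act comm_ring_hom_id)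

lemma s_act_braid: "s_act i (s_act (Suc i) (s_act i f)) = s_act (Suc i) (s_act i (s_act (Suc i) f))"
  by (rule hom_eqI) (auto intro!: comm_ring_hom_s_act comm_ring_hom_id simp: transpose_def)

lemma s_act_commute: "Suc i < j \<Longrightarrow> s_act i (s_act j f) = s_act j (s_act i f)"
  by (rule hom_eqI) (auto intro!: comm_ring_hom_s_act comm_ring_hom_id simp: transpose_def)

text \<open>
  The exponent vectors \<open>m'\<close> that can occur in \<open>\<partial>\<^sub>i
  x\<^sup>m\<close>. All later bounds on degrees and exponents come from this relation: the
  degree drops by one, and the new exponents of \<open>x\<^sub>i\<close> and
  \<open>x\<^bsub>i+1\<^esub>\<close> lie below the larger one of the old ones.
\<close>

definition ddiff_exponent :: "nat \<Rightarrow> (nat \<Rightarrow>\<^sub>0 nat) \<Rightarrow> (nat \<Rightarrow>\<^sub>0 nat) \<Rightarrow> bool" where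
  "ddiff_exponent i m m' \<longleftrightarrow>
     (\<forall>j. j \<noteq> i \<longrightarrow> j \<noteq> Suc i \<longrightarrow> Poly_Mapping.lookup m' j = Poly_Mapping.lookup m j) \<and>
     Suc (Poly_Mapping.lookup m' i + Poly_Mapping.lookup m' (Suc i)) =
       Poly_Mapping.lookup m i + Poly_Mapping.lookup m (Suc i) \<and>
     Poly_Mapping.lookup m' i < max (Poly_Mapping.lookup m i) (Poly_Mapping.lookup m (Suc i)) \<and>
     Poly_Mapping.lookup m' (Suc i) < max (Poly_Mapping.lookup m i) (Poly_Mapping.lookup m (Suc i))"

lemma keys_sum_mono: "Poly_Mapping.keys (\<Sum>k\<in>A. monomial (m k)) \<subseteq> m ` A"
  using keys_sum[of "\<lambda>k. monomial (m k)" A] by auto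

text \<open>
  After the common factor \<open>(x\<^sub>i x\<^bsub>i+1\<^esub>)\<^sup>k\<close> with
  \<open>k\<close> the smaller exponent is taken out, the numerator is
  \<open>\<plusminus>(x\<^sub>i\<^sup>d - x\<^bsub>i+1\<^esub>\<^sup>d)\<close>, and the
  quotient is a geometric sum.
\<close>

lemma monomial_divided_difference:
  "\<exists>g. (Var i - Var (Suc i)) * g = monomial m - s_act i (monomial m) \<and>
       (\<forall>m'\<in>Poly_Mapping.keys g. ddiff_exponent i m m')"
proof -
  let ?x = "Var i" and ?y = "Var (Suc i)"
  let ?s = "\<lambda>a b. Poly_Mapping.single i a + Poly_Mapping.single (Suc i) b"
  define a b where "a = Poly_Mapping.lookup m i" and "b = Poly_Mapping.lookup m (Suc i)"
  define r where "r = m - ?s a b"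
  have r0: "Poly_Mapping.lookup r i = 0" "Poly_Mapping.lookup r (Suc i) = 0"
    by (auto simp: r_def a_def b_def lookup_minus lookup_add lookup_single)
  have rj: "Poly_Mapping.lookup r j = Poly_Mapping.lookup m j" if "j \<noteq> i" "j \<noteq> Suc i" for j
    using that by (auto simp: r_def lookup_minus lookup_add lookup_single when_def)
  have m: "m = r + ?s a b"
    using r0 rj by (intro poly_mapping_eqI)
      (auto simp: lookup_add lookup_single when_def a_def b_def)
  have sp: "monomial (r + ?s c d) = monomial r * ?x ^ c * ?y ^ d" for c d
    by (simp add: monomial_add Var_power mult_ac)
  have "s_act i (monomial r) = monomial_value (\<lambda>j. Var (transpose i (Suc i) j)) r"
    by (simp add: s_act_def)
  also have "\<dots> = monomial_value Var r"
    unfolding monomial_value_def using r0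
    by (intro prod.cong) (auto simp: transpose_def in_keys_iff)
  finally have s: "s_act i (monomial r) = monomial r" by (simp add: monomial_value_Var)
  have pd: "(?x - ?y) * (\<Sum>k<d. ?y ^ (d - Suc k) * ?x ^ k) = ?x ^ d - ?y ^ d" for d
    by (simp add: power_diff_sumr2)
  have key: "ddiff_exponent i m (r + ?s (min a b + k) (min a b + (d - Suc k)))"
    if "k < d" "d = max a b - min a b" for k d
    using that r0 rj by (auto simp: ddiff_exponent_def lookup_add lookup_single a_def b_def)
  define d where "d = max a b - min a b"
  define G where "G = (\<Sum>k<d. monomial (r + ?s (min a b + k) (min a b + (d - Suc k))))"
  have kG: "\<forall>m'\<in>Poly_Mapping.keys G. ddiff_exponent i m m'"
    using keys_sum_mono[of "\<lambda>k. r + ?s (min a b + k) (min a b + (d - Suc k))" "{..<d}"] key d_def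
    unfolding G_def by blast
  have "G = monomial r * (?x * ?y) ^ min a b * (\<Sum>k<d. ?y ^ (d - Suc k) * ?x ^ k)"
    by (simp only: G_def sp sum_distrib_left power_add power_mult_distrib mult_ac)
  then have G: "(?x - ?y) * G = monomial r * (?x * ?y) ^ min a b * (?x ^ d - ?y ^ d)"
    by (simp only: pd[symmetric]) (simp only: mult_ac)
  have e: "monomial m - s_act i (monomial m) = monomial r * (?x ^ a * ?y ^ b - ?y ^ a * ?x ^ b)"
    unfolding m sp by (simp add: s algebra_simps)
  show ?thesis
  proof (cases "b \<le> a")
    case True
    then have ab: "min a b = b" "a = b + d" by (auto simp: d_def)
    have "(?x - ?y) * G = monomial m - s_act i (monomial m)"
      unfolding G e by (simp add: ab power_add power_mult_distrib algebra_simps)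
    then show ?thesis using kG by blast
  next
    case False
    then have ab: "min a b = a" "b = a + d" by (auto simp: d_def)
    have "(?x - ?y) * (- G) = monomial m - s_act i (monomial m)"
      unfolding mult_minus_right G e by (simp add: ab power_add power_mult_distrib algebra_simps)
    then show ?thesis using kG by (intro exI[of _ "- G"]) simp
  qed
qed

lemma divided_difference_exists:
  "\<exists>g. (Var i - Var (Suc i)) * g = f - s_act i f \<and>
       (\<forall>m'\<in>Poly_Mapping.keys g. \<exists>m\<in>Poly_Mapping.keys f. ddiff_exponent i m m')"
proof -
  obtain g where g: "\<And>m. (Var i - Var (Suc i)) * g m = monomial m - s_act i (monomial m)"
    "\<And>m m'. m' \<in> Poly_Mapping.keys (g m) \<Longrightarrow> ddiff_exponent i m m'"
    using monomial_divided_difference[of i] by metis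
  define c where "c = (\<lambda>m. of_int (Poly_Mapping.lookup f m) :: zpoly)"
  define G where "G = (\<Sum>m\<in>Poly_Mapping.keys f. c m * g m)"
  have f: "f = (\<Sum>m\<in>Poly_Mapping.keys f. c m * monomial m)"
    unfolding c_def by (rule zpoly_expansion) auto
  have "(Var i - Var (Suc i)) * G = (\<Sum>m\<in>Poly_Mapping.keys f. c m * (monomial m - s_act i (monomial m)))"
    unfolding G_def g(1)[symmetric] by (simp only: sum_distrib_left mult_ac)
  also have "\<dots> = f - s_act i (\<Sum>m\<in>Poly_Mapping.keys f. c m * monomial m)"
    by (subst (2) f) (simp add: s_act.hom_sum right_diff_distrib sum_subtractf c_def)
  finally have "(Var i - Var (Suc i)) * G = f - s_act i f" using f by simp
  moreover have "\<exists>m\<in>Poly_Mapping.keys f. ddiff_exponent i m m'" if m': "m' \<in> Poly_Mapping.keys G" for m'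
  proof -
    obtain m where m: "m \<in> Poly_Mapping.keys f" "m' \<in> Poly_Mapping.keys (c m * g m)"
      using m' keys_sum[of "\<lambda>m. c m * g m"] unfolding G_def by blast
    then have "m' \<in> Poly_Mapping.keys (g m)"
      using keys_mult[of "c m" "g m"] unfolding c_def of_int_zpoly
      by (auto split: if_splits)
    then show ?thesis using m(1) g(2) by blast
  qed
  ultimately show ?thesis by blast
qed

definition ddiff :: "nat \<Rightarrow> zpoly \<Rightarrow> zpoly" where
  "ddiff i f = (THE g. (Var i - Var (Suc i)) * g = f - s_act i f)"

lemma ddiff_unique: "(Var i - Var (Suc i)) * g = f - s_act i f \<Longrightarrow> ddiff i f = g"
  unfolding ddiff_def by (rule the_equality) (assumption, rule Var_diff_cancel[of i "Suc i"], simp_all)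

lemma ddiff: "(Var i - Var (Suc i)) * ddiff i f = f - s_act i f"
  using divided_difference_exists[of i f] ddiff_unique by auto

lemma keys_ddiff:
  assumes "m' \<in> Poly_Mapping.keys (ddiff i f)"
  obtains m where "m \<in> Poly_Mapping.keys f" "ddiff_exponent i m m'"
  using divided_difference_exists[of i f] ddiff_unique assms by metis

lemma ddiff_add: "ddiff i (f + g) = ddiff i f + ddiff i g"
  by (rule ddiff_unique) (simp add: distrib_left ddiff)

lemma ddiff_Leibniz: "ddiff i (f * g) = ddiff i f * g + s_act i f * ddiff i g"
proof (rule ddiff_unique)
  have "(Var i - Var (Suc i)) * (ddiff i f * g + s_act i f * ddiff i g) =
     ((Var i - Var (Suc i)) * ddiff i f) * g + s_act i f * ((Var i - Var (Suc i)) * ddiff i g)"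
    by (simp add: algebra_simps)
  then show "(Var i - Var (Suc i)) * (ddiff i f * g + s_act i f * ddiff i g) =
     f * g - s_act i (f * g)"
    unfolding ddiff by (simp add: algebra_simps)
qed

lemma ddiff_invariant: "s_act i c = c \<Longrightarrow> ddiff i c = 0"
  by (rule ddiff_unique) simp

lemma ddiff_invariant_mult: "s_act i c = c \<Longrightarrow> ddiff i (c * f) = c * ddiff i f"
  by (simp add: ddiff_Leibniz ddiff_invariant)

lemma ddiff_zero [simp]: "ddiff i 0 = 0"
  by (rule ddiff_unique) simp

section \<open>Isobaric divided differences\<close>

lemma demazure_unique:
  "(Var i - Var (Suc i)) * g = (1 - Var (Suc i)) * f - (1 - Var i) * s_act i f \<Longrightarrow> demazure i f = g"
  unfolding demazure_def
  by (rule the_equality) (simp add: transpose_def, rule Var_diff_cancel[of i "Suc i"], simp_all)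

text \<open>
  So \<open>\<pi>\<^sub>i - 1\<close> is \<open>(1 - x\<^sub>i) \<partial>\<^sub>i\<close>. This
  is why coordinates with respect to Grothendieck polynomials can be computed with ordinary
  divided differences.
\<close>

lemma demazure_ddiff: "demazure i f = f + (1 - Var i) * ddiff i f"
proof (rule demazure_unique)
  have "(Var i - Var (Suc i)) * (f + (1 - Var i) * ddiff i f) =
    (Var i - Var (Suc i)) * f + (1 - Var i) * ((Var i - Var (Suc i)) * ddiff i f)"
    by (simp add: algebra_simps)
  then show "(Var i - Var (Suc i)) * (f + (1 - Var i) * ddiff i f) =
     (1 - Var (Suc i)) * f - (1 - Var i) * s_act i f"
    unfolding ddiff by (simp add: algebra_simps)
qed

lemma demazure:
  "(Var i - Var (Suc i)) * demazure i f = (1 - Var (Suc i)) * f - (1 - Var i) * s_act i f"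
proof -
  have "(Var i - Var (Suc i)) * demazure i f =
    (Var i - Var (Suc i)) * f + (1 - Var i) * ((Var i - Var (Suc i)) * ddiff i f)"
    by (simp add: demazure_ddiff algebra_simps)
  then show ?thesis unfolding ddiff by (simp add: algebra_simps)
qed

lemma demazure_invariant: "s_act i c = c \<Longrightarrow> demazure i c = c"
  by (simp add: demazure_ddiff ddiff_invariant)

lemma demazure_invariant_mult: "s_act i c = c \<Longrightarrow> demazure i (c * f) = c * demazure i f"
  by (simp add: demazure_ddiff ddiff_invariant_mult algebra_simps)

lemma demazure_add: "demazure i (f + g) = demazure i f + demazure i g"
  by (simp add: demazure_ddiff ddiff_add algebra_simps)

lemma demazure_zero [simp]: "demazure i 0 = 0"
  by (simp add: demazure_ddiff)

lemma s_act_demazure: "s_act i (demazure i f) = demazure i f"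
proof (rule Var_diff_cancel[of i "Suc i"])
  have "s_act i ((Var i - Var (Suc i)) * demazure i f) =
      s_act i ((1 - Var (Suc i)) * f - (1 - Var i) * s_act i f)"
    by (simp only: demazure)
  then have "(Var (Suc i) - Var i) * s_act i (demazure i f) = (1 - Var i) * s_act i f - (1 - Var (Suc i)) * f"
    by simp
  then show "(Var i - Var (Suc i)) * s_act i (demazure i f) = (Var i - Var (Suc i)) * demazure i f"
    unfolding demazure by (simp add: algebra_simps)
qed simp

lemma demazure_idem: "demazure i (demazure i f) = demazure i f"
  by (simp add: demazure_invariant s_act_demazure)

lemma s_act_demazure_commute:
  assumes "Suc i < j \<or> Suc j < i"
  shows "s_act i (demazure j f) = demazure j (s_act i f)"
proof (rule demazure_unique[symmetric])
  have "s_act i ((Var j - Var (Suc j)) * demazure j f) =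
      s_act i ((1 - Var (Suc j)) * f - (1 - Var j) * s_act j f)"
    by (simp only: demazure)
  moreover have "s_act i (s_act j f) = s_act j (s_act i f)"
    using assms s_act_commute by metis
  ultimately show "(Var j - Var (Suc j)) * s_act i (demazure j f) =
     (1 - Var (Suc j)) * s_act i f - (1 - Var j) * s_act j (s_act i f)"
    using assms by (auto simp: transpose_def)
qed

lemma demazure_commute:
  assumes "Suc i < j"
  shows "demazure i (demazure j f) = demazure j (demazure i f)"
proof (rule demazure_unique)
  have "(Var i - Var (Suc i)) * demazure j (demazure i f) =
      demazure j ((Var i - Var (Suc i)) * demazure i f)"
    using assms by (subst demazure_invariant_mult) (auto simp: transpose_def)
  also have "\<dots> = demazure j ((1 - Var (Suc i)) * f + (Var i - 1) * s_act i f)"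
    unfolding demazure by (simp add: algebra_simps)
  also have "\<dots> = (1 - Var (Suc i)) * demazure j f + (Var i - 1) * demazure j (s_act i f)"
    unfolding demazure_add using assms
    by (subst (1 2) demazure_invariant_mult) (auto simp: transpose_def)
  also have "demazure j (s_act i f) = s_act i (demazure j f)"
    using assms by (simp add: s_act_demazure_commute)
  finally show "(Var i - Var (Suc i)) * demazure j (demazure i f) =
     (1 - Var (Suc i)) * demazure j f - (1 - Var i) * s_act i (demazure j f)"
    by (simp add: algebra_simps)
qed

text \<open>
  Multiplied by the Vandermonde determinant of \<open>x\<^sub>i, x\<^bsub>i+1\<^esub>,
  x\<^bsub>i+2\<^esub>\<close>, both sides become the antisymmetrization of \<open>(1 -
  x\<^bsub>i+1\<^esub>) (1 - x\<^bsub>i+2\<^esub>)\<^sup>2 f\<close>, a sum over six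
  permutations.
\<close>

lemma demazure_braid:
  "demazure i (demazure (Suc i) (demazure i f)) =
   demazure (Suc i) (demazure i (demazure (Suc i) f))"
proof -
  let ?i = "Suc i"
  define a b c where "a = Var i" and "b = Var (Suc i)" and "c = Var (Suc (Suc i))"
  have s [simp]: "s_act i a = b" "s_act i b = a" "s_act i c = c"
    and r [simp]: "s_act ?i a = a" "s_act ?i b = c" "s_act ?i c = b"
    by (simp_all add: a_def b_def c_def transpose_def)
  have ab: "(a - b) * demazure i f = (1 - b) * f - (1 - a) * s_act i f" for f
    unfolding a_def b_def by (rule demazure)
  have bc: "(b - c) * demazure ?i f = (1 - c) * f - (1 - b) * s_act ?i f" for f
    unfolding b_def c_def by (rule demazure)
  have ac: "(a - c) * s_act ?i (demazure i f) =
      (1 - c) * s_act ?i f - (1 - a) * s_act ?i (s_act i f)" for f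
    using arg_cong[OF ab, of "s_act ?i" f] by simp
  have ac': "(a - c) * s_act i (demazure ?i f) =
      (1 - c) * s_act i f - (1 - a) * s_act i (s_act ?i f)" for f
    using arg_cong[OF bc, of "s_act i" f] by simp
  have bc': "(b - c) * s_act i (s_act ?i (demazure i f)) =
      (1 - c) * s_act i (s_act ?i f) - (1 - b) * s_act i (s_act ?i (s_act i f))" for f
    using arg_cong[OF ac, of "s_act i" f] by simp
  have ab': "(a - b) * s_act ?i (s_act i (demazure ?i f)) =
      (1 - b) * s_act ?i (s_act i f) - (1 - a) * s_act ?i (s_act i (s_act ?i f))" for f
    using arg_cong[OF ac', of "s_act ?i" f] by simp
  let ?D = "(a - b) * (a - c) * (b - c)"
  let ?A = "(1 - c)\<^sup>2 * ((1 - b) * f - (1 - a) * s_act i f)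
     - (1 - b)\<^sup>2 * ((1 - c) * s_act ?i f - (1 - a) * s_act ?i (s_act i f))
     + (1 - a)\<^sup>2 * ((1 - c) * s_act i (s_act ?i f) - (1 - b) * s_act i (s_act ?i (s_act i f)))"
  have "?D * demazure i (demazure ?i (demazure i f)) =
      (a - c) * (b - c) * ((a - b) * demazure i (demazure ?i (demazure i f)))"
    by (simp only: mult_ac)
  also have "\<dots> = (a - c) * (1 - b) * ((b - c) * demazure ?i (demazure i f))
      - (b - c) * (1 - a) * ((a - c) * s_act i (demazure ?i (demazure i f)))"
    unfolding ab by (simp add: algebra_simps)
  also have "\<dots> = (1 - c)\<^sup>2 * ((a - b) * demazure i f)
      - (1 - b)\<^sup>2 * ((a - c) * s_act ?i (demazure i f))
      + (1 - a)\<^sup>2 * ((b - c) * s_act i (s_act ?i (demazure i f)))"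
    unfolding bc ac' by (simp add: s_act_demazure algebra_simps power2_eq_square)
  also have "\<dots> = ?A"
    unfolding ab ac bc' ..
  finally have 1: "?D * demazure i (demazure ?i (demazure i f)) = ?A" .
  have "?D * demazure ?i (demazure i (demazure ?i f)) =
      (a - c) * (a - b) * ((b - c) * demazure ?i (demazure i (demazure ?i f)))"
    by (simp only: mult_ac)
  also have "\<dots> = (a - c) * (1 - c) * ((a - b) * demazure i (demazure ?i f))
      - (a - b) * (1 - b) * ((a - c) * s_act ?i (demazure i (demazure ?i f)))"
    unfolding bc by (simp add: algebra_simps)
  also have "\<dots> = (1 - b) * (1 - c) * ((b - c) * demazure ?i f)
      - (1 - a) * (1 - c) * ((a - c) * s_act i (demazure ?i f))
      + (1 - a) * (1 - b) * ((a - b) * s_act ?i (s_act i (demazure ?i f)))"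
    unfolding ab ac by (simp add: s_act_demazure algebra_simps power2_eq_square)
  also have "\<dots> = ?A"
    unfolding bc ac' ab' s_act_braid[symmetric]
    by (simp add: algebra_simps power2_eq_square)
  finally have "?D * demazure i (demazure ?i (demazure i f)) = ?D * demazure ?i (demazure i (demazure ?i f))"
    using 1 by simp
  moreover have "?D \<noteq> 0" by (simp add: a_def b_def c_def)
  ultimately show ?thesis by simp
qed

section \<open>Inversions and reduced words\<close>

abbreviation adj :: "nat \<Rightarrow> nat \<Rightarrow> nat" where
  "adj i \<equiv> transpose i (Suc i)"

definition inversions :: "(nat \<Rightarrow> nat) \<Rightarrow> (nat \<times> nat) set" where
  "inversions v = {(a, b). a < b \<and> v b < v a}"

definition inv_count :: "(nat \<Rightarrow> nat) \<Rightarrow> nat" where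
  "inv_count v = card (inversions v)"

lemma Sym_mono: "m \<le> n \<Longrightarrow> Sym m \<subseteq> Sym n"
  unfolding Sym_def by (auto intro: permutes_subset)

lemma Sym_inf_iff: "w \<in> Sym_inf \<longleftrightarrow> (\<exists>n. w \<in> Sym n)"
  by (auto simp: Sym_inf_def)

lemma Sym_subset_Sym_inf: "Sym n \<subseteq> Sym_inf"
  by (auto simp: Sym_inf_def)

lemma Sym_fixes: "w \<in> Sym n \<Longrightarrow> n < i \<Longrightarrow> w i = i"
  by (auto simp: Sym_def permutes_def)

lemma Sym_le: "w \<in> Sym n \<Longrightarrow> i \<le> n \<Longrightarrow> w i \<le> n"
  unfolding Sym_def by (metis One_nat_def Suc_leI atLeastAtMost_iff bot_nat_0.not_eq_extremum
      mem_Collect_eq permutes_in_image permutes_not_in)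

lemma Sym_inf_bij: "w \<in> Sym_inf \<Longrightarrow> bij w"
  by (auto simp: Sym_inf_def Sym_def permutes_bij)

lemma Sym_inf_eq_iff: "w \<in> Sym_inf \<Longrightarrow> w a = w b \<longleftrightarrow> a = b"
  using Sym_inf_bij[of w] by (auto simp: bij_def inj_def)

lemma Sym_inf_zero: "w \<in> Sym_inf \<Longrightarrow> w 0 = 0"
  by (auto simp: Sym_inf_def Sym_def permutes_def)

lemma Sym_id: "id \<in> Sym n"
  by (simp add: Sym_def permutes_id)

lemma Sym_comp: "u \<in> Sym n \<Longrightarrow> v \<in> Sym n \<Longrightarrow> u \<circ> v \<in> Sym n"
  by (simp add: Sym_def permutes_compose)

lemma Sym_inv: "u \<in> Sym n \<Longrightarrow> inv u \<in> Sym n"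
  by (simp add: Sym_def permutes_inv)

lemma Sym_adj: "1 \<le> i \<Longrightarrow> i < n \<Longrightarrow> adj i \<in> Sym n"
  by (auto simp: Sym_def intro: permutes_swap_id)

lemma Sym_inf_common:
  assumes "u \<in> Sym_inf" "v \<in> Sym_inf"
  obtains n where "u \<in> Sym n" "v \<in> Sym n" "(k::nat) \<le> n"
proof -
  obtain a b where "u \<in> Sym a" "v \<in> Sym b" using assms by (auto simp: Sym_inf_def)
  moreover have "Sym a \<subseteq> Sym (max k (max a b))" "Sym b \<subseteq> Sym (max k (max a b))"
    by (rule Sym_mono; simp)+
  ultimately show ?thesis using that[of "max k (max a b)"] by auto
qed

lemma Sym_inf_comp: "u \<in> Sym_inf \<Longrightarrow> v \<in> Sym_inf \<Longrightarrow> u \<circ> v \<in> Sym_inf"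
  by (metis Sym_comp Sym_inf_common Sym_inf_iff)

lemma Sym_inf_inv: "u \<in> Sym_inf \<Longrightarrow> inv u \<in> Sym_inf"
  by (metis Sym_inv Sym_inf_iff)

lemma Sym_inf_adj: "1 \<le> i \<Longrightarrow> adj i \<in> Sym_inf"
  unfolding Sym_inf_iff using Sym_adj[of i "Suc i"] by blast

lemma inv_count_id [simp]: "inv_count id = 0"
proof -
  have "inversions id = {}" by (auto simp: inversions_def)
  then show ?thesis by (simp add: inv_count_def)
qed

lemma finite_inversions:
  assumes "v \<in> Sym_inf"
  shows "finite (inversions v)"
proof -
  obtain n where n: "v \<in> Sym n" using assms by (auto simp: Sym_inf_def)
  have "inversions v \<subseteq> {..n} \<times> {..n}"
  proof (clarsimp simp: inversions_def)
    fix a b assume ab: "a < b" "v b < v a"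
    then have "\<not> n < b" using Sym_fixes[OF n, of b] Sym_fixes[OF n, of a] Sym_le[OF n, of a]
      by (cases "a \<le> n") auto
    then show "a \<le> n \<and> b \<le> n" using ab by simp
  qed
  then show ?thesis by (rule finite_subset) simp
qed

text \<open>
  Exchanging the values at \<open>i\<close> and \<open>i + 1\<close> relabels the inversions and
  creates exactly one new one.
\<close>

lemma inv_count_comp_adj:
  assumes "v \<in> Sym_inf" "v i < v (Suc i)"
  shows "inv_count (v \<circ> adj i) = Suc (inv_count v)"
proof -
  let ?s = "map_prod (adj i) (adj i)"
  have s: "adj i a < adj i b \<longleftrightarrow> (a < b \<and> (a, b) \<noteq> (i, Suc i)) \<or> (a = Suc i \<and> b = i)" for a b
    by (auto simp: transpose_def)
  have "inversions (v \<circ> adj i) = insert (i, Suc i) (?s ` inversions v)"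
  proof (rule set_eqI, clarify)
    fix a b
    have im: "(a, b) \<in> ?s ` inversions v \<longleftrightarrow> (adj i a, adj i b) \<in> inversions v"
      by (force simp: image_iff)
    show "(a, b) \<in> inversions (v \<circ> adj i) \<longleftrightarrow> (a, b) \<in> insert (i, Suc i) (?s ` inversions v)"
      unfolding insert_iff im using assms(2) s[of a b]
      by (auto simp: inversions_def)
  qed
  moreover have "(i, Suc i) \<notin> ?s ` inversions v"
    by (auto simp: inversions_def transpose_def split: if_splits)
  moreover have "inj_on ?s (inversions v)"
    by (rule inj_on_subset[OF prod.inj_map[OF inj_transpose inj_transpose]]) simp
  ultimately show ?thesis
    using finite_inversions[OF assms(1)] by (simp add: inv_count_def card_image)
qed

lemma comp_adj_adj [simp]: "v \<circ> adj i \<circ> adj i = v"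
  by (simp add: fun_eq_iff)

lemma inv_count_comp_adj_descent:
  assumes "v \<in> Sym_inf" "1 \<le> i" "v (Suc i) < v i"
  shows "inv_count v = Suc (inv_count (v \<circ> adj i))"
  using inv_count_comp_adj[of "v \<circ> adj i" i] assms by (simp add: Sym_inf_comp Sym_inf_adj)

lemma adj_cases:
  assumes "v \<in> Sym_inf"
  obtains "v i < v (Suc i)" | "v (Suc i) < v i"
  using Sym_inf_eq_iff[OF assms, of i "Suc i"] by (metis n_not_Suc_n nat_neq_iff)

lemma inv_count_inv:
  assumes "v \<in> Sym_inf"
  shows "inv_count (inv v) = inv_count v"
proof -
  note b = Sym_inf_bij[OF assms]
  let ?f = "\<lambda>(a, b). (v b, v a)"
  have "inversions (inv v) = ?f ` inversions v"
  proof (rule set_eqI, clarify)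
    fix c d
    obtain x y where "c = v x" "d = v y" using b by (metis bij_pointE)
    then show "(c, d) \<in> inversions (inv v) \<longleftrightarrow> (c, d) \<in> ?f ` inversions v"
      using b by (auto simp: inversions_def image_iff bij_is_inj dest: bij_is_inj injD)
  qed
  moreover have "inj_on ?f (inversions v)"
    using Sym_inf_eq_iff[OF assms] by (auto simp: inj_on_def)
  ultimately show ?thesis by (simp add: inv_count_def card_image)
qed

lemma inv_count_adj_comp:
  assumes "v \<in> Sym_inf" "1 \<le> i" "inv v i < inv v (Suc i)"
  shows "inv_count (adj i \<circ> v) = Suc (inv_count v)"
proof -
  have "inv (adj i \<circ> v) = inv v \<circ> adj i"
    using Sym_inf_bij[OF assms(1)] by (subst o_inv_distrib) auto
  then have "inv_count (adj i \<circ> v) = inv_count (inv v \<circ> adj i)"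
    using inv_count_inv[of "adj i \<circ> v"] assms by (simp add: Sym_inf_comp Sym_inf_adj)
  then show ?thesis
    using inv_count_comp_adj[of "inv v" i] inv_count_inv[of v] assms by (simp add: Sym_inf_inv)
qed

lemma no_descent_imp_id:
  assumes "v \<in> Sym_inf" "\<And>i. 1 \<le> i \<Longrightarrow> v i < v (Suc i)"
  shows "v = id"
proof
  fix i
  obtain n where n: "v \<in> Sym n" using assms(1) by (auto simp: Sym_inf_def)
  have step: "v i < v (Suc i)" for i
    using assms(2)[of i] Sym_inf_zero[OF assms(1)] Sym_inf_eq_iff[OF assms(1), of 0 1]
    by (cases "i = 0") auto
  then have "strict_mono v" by (simp add: strict_mono_Suc_iff)
  then have "i \<le> v i" by (rule strict_mono_imp_increasing)
  moreover have "v i + k \<le> v (i + k)" for k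
    by (induction k) (use step in \<open>auto simp: Suc_le_eq intro: le_less_trans\<close>)
  from this[of "Suc n"] have "v i \<le> i" using Sym_fixes[OF n, of "i + Suc n"] by simp
  ultimately show "v i = id i" by simp
qed

lemma word_perm_Nil [simp]: "word_perm [] = id"
  and word_perm_Cons [simp]: "word_perm (i # is) = adj i \<circ> word_perm is"
  by (simp_all add: word_perm_def)

lemma word_perm_append [simp]: "word_perm (is @ js) = word_perm is \<circ> word_perm js"
  by (induction "is") (auto simp: comp_assoc)

lemma word_perm_Sym: "set is \<subseteq> {1..<n} \<Longrightarrow> word_perm is \<in> Sym n"
  by (induction "is") (auto intro!: Sym_id Sym_comp Sym_adj)

lemma word_perm_Sym_inf: "set is \<subseteq> {1..} \<Longrightarrow> word_perm is \<in> Sym_inf"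
  by (induction "is") (auto intro!: Sym_inf_comp Sym_inf_adj simp: Sym_id[THEN Sym_subset_Sym_inf[THEN subsetD]])

lemma inv_count_word_perm_le: "set is \<subseteq> {1..} \<Longrightarrow> inv_count (word_perm is) \<le> length is"
proof (induction "is" rule: rev_induct)
  case Nil
  show ?case unfolding word_perm_Nil inv_count_id by simp
next
  case (snoc i "is")
  then have v: "word_perm is \<in> Sym_inf" by (intro word_perm_Sym_inf) auto
  have e: "word_perm (is @ [i]) = word_perm is \<circ> adj i" by simp
  show ?case unfolding e
    by (rule adj_cases[OF v, of i])
      (use inv_count_comp_adj[OF v, of i] inv_count_comp_adj_descent[OF v, of i] snoc in \<open>auto simp: comp_def\<close>)
qed

lemma short_word_exists:
  assumes "v \<in> Sym n"
  shows "\<exists>is. set is \<subseteq> {1..<n} \<and> word_perm is = v \<and> length is = inv_count v"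
  using assms
proof (induction "inv_count v" arbitrary: v)
  case 0
  have v: "v \<in> Sym_inf" using 0 by (auto simp: Sym_inf_iff)
  have "v = id"
  proof (rule no_descent_imp_id[OF v])
    fix i :: nat assume "1 \<le> i"
    then show "v i < v (Suc i)"
      by (cases rule: adj_cases[OF v, of i]) (use inv_count_comp_adj_descent[OF v, of i] 0 in auto)
  qed
  then show ?case using 0 by (intro exI[of _ "[]"]) auto
next
  case (Suc k)
  have v: "v \<in> Sym_inf" using Suc by (auto simp: Sym_inf_iff)
  have "v \<noteq> id" using Suc(2) by auto
  then obtain i where i: "1 \<le> i" "v (Suc i) < v i"
    using no_descent_imp_id[OF v] adj_cases[OF v] by metis
  have "i < n"
    using Sym_fixes[OF Suc(3), of i] Sym_fixes[OF Suc(3), of "Suc i"] Sym_le[OF Suc(3), of i] i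
    by (metis Suc_le_eq less_Suc_eq_le linorder_not_less order_less_le_trans not_less_iff_gr_or_eq)
  then have "v \<circ> adj i \<in> Sym n" using i Suc(3) by (intro Sym_comp Sym_adj) auto
  moreover have "k = inv_count (v \<circ> adj i)"
    using inv_count_comp_adj_descent[OF v i] Suc(2) by simp
  ultimately obtain "is" where "set is \<subseteq> {1..<n}" "word_perm is = v \<circ> adj i"
      "length is = inv_count (v \<circ> adj i)"
    using Suc(1)[of "v \<circ> adj i"] by blast
  then show ?case
    using inv_count_comp_adj_descent[OF v i] i \<open>i < n\<close> by (intro exI[of _ "is @ [i]"]) auto
qed

text \<open>
  The number of inversions changes by one with each letter and reaches \<open>0\<close> along
  descents, so it is the minimal length of a word.
\<close>

lemma reduced_word_iff:
  assumes "v \<in> Sym_inf"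
  shows "reduced_word v is \<longleftrightarrow> set is \<subseteq> {1..} \<and> word_perm is = v \<and> length is = inv_count v"
proof -
  obtain n where "v \<in> Sym n" using assms by (auto simp: Sym_inf_def)
  then obtain js where "set js \<subseteq> {1..<n}" "word_perm js = v" "length js = inv_count v"
    using short_word_exists by blast
  then have "\<exists>js. set js \<subseteq> {1..} \<and> word_perm js = v \<and> length js = inv_count v"
    by (intro exI[of _ js]) auto
  then show ?thesis
    using inv_count_word_perm_le unfolding reduced_word_def is_arg_min_def
    by (metis le_antisym linorder_not_less)
qed

lemma reduced_word_exists:
  assumes "v \<in> Sym n"
  obtains "is" where "set is \<subseteq> {1..<n}" "reduced_word v is"
proof -
  have v: "v \<in> Sym_inf" using assms by (auto simp: Sym_inf_iff)
  then show ?thesis using short_word_exists[OF assms] that by (fastforce simp: reduced_word_iff)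
qed

lemma reduced_wordD:
  assumes "reduced_word v is"
  shows "set is \<subseteq> {1..}" "word_perm is = v" "v \<in> Sym_inf" "length is = inv_count v"
proof -
  show 1: "set is \<subseteq> {1..}" "word_perm is = v"
    using assms by (auto simp: reduced_word_def is_arg_min_def)
  then show 2: "v \<in> Sym_inf" using word_perm_Sym_inf by blast
  then show "length is = inv_count v" using assms by (simp add: reduced_word_iff)
qed

lemma reduced_word_id: "reduced_word id []"
  by (simp add: reduced_word_def is_arg_min_def)

lemma reduced_word_snoc:
  assumes "reduced_word v is" "1 \<le> i" "v i < v (Suc i)"
  shows "reduced_word (v \<circ> adj i) (is @ [i])"
  using reduced_wordD[OF assms(1)] assms
  by (simp add: reduced_word_iff inv_count_comp_adj Sym_inf_comp Sym_inf_adj)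

lemma reduced_word_Cons:
  assumes "reduced_word v is" "1 \<le> i" "inv v i < inv v (Suc i)"
  shows "reduced_word (adj i \<circ> v) (i # is)"
  using reduced_wordD[OF assms(1)] assms
  by (simp add: reduced_word_iff inv_count_adj_comp Sym_inf_comp Sym_inf_adj)

lemma reduced_word_snocD:
  assumes "reduced_word v (is @ [i])"
  shows "1 \<le> i" "reduced_word (v \<circ> adj i) is" "v (Suc i) < v i"
proof -
  note r = reduced_wordD[OF assms]
  show i: "1 \<le> i" using r(1) by simp
  have p: "word_perm is = v \<circ> adj i" unfolding r(2)[symmetric] by simp
  have le: "inv_count (v \<circ> adj i) \<le> length is"
    unfolding p[symmetric] using r(1) by (intro inv_count_word_perm_le) auto
  show d: "v (Suc i) < v i"
    by (rule adj_cases[OF r(3), of i]) (use le r(4) inv_count_comp_adj[OF r(3), of i] in auto)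
  show "reduced_word (v \<circ> adj i) is"
    using r p i inv_count_comp_adj_descent[OF r(3) i d]
    by (simp add: reduced_word_iff Sym_inf_comp Sym_inf_adj)
qed

lemma reduced_word_descent:
  assumes "v \<in> Sym_inf" "1 \<le> i" "v (Suc i) < v i" "reduced_word (v \<circ> adj i) is"
  shows "reduced_word v (is @ [i])"
  using reduced_word_snoc[OF assms(4,2)] assms by simp

locale braid_family =
  fixes T :: "nat \<Rightarrow> 'b \<Rightarrow> 'b"
  assumes T_commute: "1 \<le> i \<Longrightarrow> Suc i < j \<Longrightarrow> T i (T j x) = T j (T i x)"
    and T_braid: "1 \<le> i \<Longrightarrow> T i (T (Suc i) (T i x)) = T (Suc i) (T i (T (Suc i) x))"
begin

text \<open>
  If \<open>i\<close> and \<open>j\<close> are both descents of \<open>v\<close>, then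
  \<open>v\<close> has reduced words that end in the two words of the longest element of the
  subgroup generated by \<open>s\<^sub>i\<close> and \<open>s\<^sub>j\<close>; one relation
  converts them into each other.
\<close>

lemma two_descents:
  assumes v: "v \<in> Sym_inf" and i: "1 \<le> i" "i < j"
    and d: "v (Suc i) < v i" "v (Suc j) < v j"
  obtains as bs where "reduced_word (v \<circ> adj i) as" "reduced_word (v \<circ> adj j) bs"
    "foldr T as (T i x) = foldr T bs (T j x)"
proof -
  have si: "v \<circ> adj i \<in> Sym_inf" and sj: "v \<circ> adj j \<in> Sym_inf"
    using v i by (intro Sym_inf_comp Sym_inf_adj; simp)+
  have j: "1 \<le> j" using i by simp
  have sij: "v \<circ> adj i \<circ> adj j \<in> Sym_inf" and sji: "v \<circ> adj j \<circ> adj i \<in> Sym_inf"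
    using Sym_inf_comp[OF si Sym_inf_adj[OF j]] Sym_inf_comp[OF sj Sym_inf_adj[OF i(1)]] by simp_all
  show ?thesis
  proof (cases "j = Suc i")
    case False
    obtain ks where ks: "reduced_word (v \<circ> adj i \<circ> adj j) ks"
      using reduced_word_exists sij Sym_inf_iff by metis
    have e: "v \<circ> adj i \<circ> adj j = v \<circ> adj j \<circ> adj i"
      using i False by (auto simp: fun_eq_iff transpose_def)
    have "(v \<circ> adj i) (Suc j) < (v \<circ> adj i) j" "(v \<circ> adj j) (Suc i) < (v \<circ> adj j) i"
      using i d False by (auto simp: transpose_def)
    then have "reduced_word (v \<circ> adj i) (ks @ [j])" "reduced_word (v \<circ> adj j) (ks @ [i])"
      using reduced_word_descent[OF si j _ ks] reduced_word_descent[OF sj i(1) _ ks[unfolded e]]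
      by simp_all
    then show ?thesis using that T_commute[of i j x] i False by auto
  next
    case True
    have "v \<circ> adj i \<circ> adj j \<circ> adj i \<in> Sym_inf"
      using Sym_inf_comp[OF sij Sym_inf_adj[OF i(1)]] .
    then obtain ks where ks: "reduced_word (v \<circ> adj i \<circ> adj j \<circ> adj i) ks"
      using reduced_word_exists Sym_inf_iff by metis
    have e: "v \<circ> adj i \<circ> adj j \<circ> adj i = v \<circ> adj j \<circ> adj i \<circ> adj j"
      using True by (auto simp: fun_eq_iff transpose_def)
    have "(v \<circ> adj i \<circ> adj j) (Suc i) < (v \<circ> adj i \<circ> adj j) i"
      "(v \<circ> adj j \<circ> adj i) (Suc j) < (v \<circ> adj j \<circ> adj i) j"
      using d True by (auto simp: transpose_def)
    then have 1: "reduced_word (v \<circ> adj i \<circ> adj j) (ks @ [i])"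
      "reduced_word (v \<circ> adj j \<circ> adj i) (ks @ [j])"
      using reduced_word_descent[OF sij i(1) _ ks] reduced_word_descent[OF sji j _ ks[unfolded e]]
      by simp_all
    have "(v \<circ> adj i) (Suc j) < (v \<circ> adj i) j" "(v \<circ> adj j) (Suc i) < (v \<circ> adj j) i"
      using d True by (auto simp: transpose_def)
    then have "reduced_word (v \<circ> adj i) ((ks @ [i]) @ [j])" "reduced_word (v \<circ> adj j) ((ks @ [j]) @ [i])"
      using reduced_word_descent[OF si j _ 1(1)] reduced_word_descent[OF sj i(1) _ 1(2)]
      by simp_all
    then show ?thesis using that T_braid[of i x] i True by auto
  qed
qed

text \<open>
  Matsumoto's theorem. If the last letters differ, both words are compared by induction with the
  words supplied by \<open>two_descents\<close>.
\<close>

lemma foldr_reduced_word_unique: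
  "reduced_word v is \<Longrightarrow> reduced_word v js \<Longrightarrow> foldr T is x = foldr T js x"
proof (induction "length is" arbitrary: v "is" js x)
  case 0
  then show ?case using reduced_wordD(4)[of v "is"] reduced_wordD(4)[of v js] by simp
next
  case (Suc n)
  have len: "length js = length is"
    using reduced_wordD(4)[OF Suc(3)] reduced_wordD(4)[OF Suc(4)] by simp
  obtain as i where as: "is = as @ [i]" using Suc(2) by (cases "is" rule: rev_cases) auto
  obtain bs j where bs: "js = bs @ [j]" using Suc(2) len by (cases js rule: rev_cases) auto
  note ri = reduced_word_snocD[OF Suc(3)[unfolded as]] and rj = reduced_word_snocD[OF Suc(4)[unfolded bs]]
  have n: "n = length as" "n = length bs" using Suc(2) len as bs by auto
  note v = reduced_wordD(3)[OF Suc(3)]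
  consider "i = j" | "i < j" | "j < i" by linarith
  then show ?case
  proof cases
    case 1
    then show ?thesis using Suc(1)[OF n(1) ri(2), of bs "T i x"] rj(2) as bs by simp
  next
    case 2
    obtain cs ds where "reduced_word (v \<circ> adj i) cs" "reduced_word (v \<circ> adj j) ds"
      "foldr T cs (T i x) = foldr T ds (T j x)"
      using two_descents[OF v ri(1) 2 ri(3) rj(3)] by metis
    then show ?thesis
      using Suc(1)[OF n(1) ri(2), of cs] Suc(1)[OF n(2) rj(2), of ds] as bs by simp
  next
    case 3
    obtain cs ds where "reduced_word (v \<circ> adj j) cs" "reduced_word (v \<circ> adj i) ds"
      "foldr T cs (T j x) = foldr T ds (T i x)"
      using two_descents[OF v rj(1) 3 rj(3) ri(3)] by metis
    then show ?thesis
      using Suc(1)[OF n(2) rj(2), of cs] Suc(1)[OF n(1) ri(2), of ds] as bs by simp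
  qed
qed

end

section \<open>Cycles and increasing completions\<close>

lemma word_perm_upt:
  "a \<le> b \<Longrightarrow> word_perm [a..<b] x = (if x = b then a else if a \<le> x \<and> x < b then Suc x else x)"
proof (induction b arbitrary: x)
  case (Suc b)
  then show ?case by (cases "a = Suc b") (auto simp: transpose_def)
qed auto

lemma word_perm_rev_upt:
  "a \<le> b \<Longrightarrow> word_perm (rev [a..<b]) x = (if x = a then b else if a < x \<and> x \<le> b then x - 1 else x)"
proof (induction b arbitrary: x)
  case (Suc b)
  then show ?case by (cases "a = Suc b") (auto simp: transpose_def)
qed auto

lemma reduced_word_append_cycle:
  assumes "a \<le> b" "reduced_word v is" "1 \<le> a" "\<And>x. a \<le> x \<Longrightarrow> x < b \<Longrightarrow> v x < v b"
  shows "reduced_word (v \<circ> word_perm (rev [a..<b])) (is @ rev [a..<b])"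
  using assms(1,3,4)
proof (induction rule: inc_induct)
  case base
  then show ?case using assms(2) by simp
next
  case (step a)
  have "reduced_word (v \<circ> word_perm (rev [Suc a..<b]) \<circ> adj a) ((is @ rev [Suc a..<b]) @ [a])"
  proof (rule reduced_word_snoc)
    show "reduced_word (v \<circ> word_perm (rev [Suc a..<b])) (is @ rev [Suc a..<b])"
      by (rule step.IH) (use step in auto)
    show "(v \<circ> word_perm (rev [Suc a..<b])) a < (v \<circ> word_perm (rev [Suc a..<b])) (Suc a)"
      using step by (simp add: word_perm_rev_upt)
  qed (use step in simp)
  moreover have "rev [a..<b] = rev [Suc a..<b] @ [a]"
    using step by (simp add: upt_conv_Cons)
  moreover have "word_perm [a] = adj a" by simp
  ultimately show ?case by (simp only: word_perm_append comp_assoc append_assoc)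
qed

text \<open>
  At the first position where two candidates differ, the smaller value would have to be taken by
  the other candidate at a later position, against monotonicity.
\<close>

lemma increasing_completion_eq:
  assumes "w \<in> Sym_inf" "map w [1..<length xs + 1] = xs" "strict_mono_on {length xs<..} w"
  shows "increasing_completion xs = w"
  unfolding increasing_completion_def
proof (rule the_equality)
  fix w' assume w': "w' \<in> Sym_inf \<and> map w' [1..<length xs + 1] = xs \<and> strict_mono_on {length xs<..} w'"
  have small: "w i = w' i" if "i \<le> length xs" for i
  proof (cases "i = 0")
    case False
    then have "map w [1..<length xs + 1] ! (i - 1) = map w' [1..<length xs + 1] ! (i - 1)"
      using assms w' by simp
    then show ?thesis using False that by (simp add: nth_append del: upt_Suc)
  next
    case True
    then show ?thesis using assms(1) w' by (simp add: Sym_inf_zero)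
  qed
  \<comment> \<open>Stated for two arbitrary candidates, since it is used in both directions.\<close>
  have aux: "\<not> u i < u' i"
    if t: "u \<in> Sym_inf" "u' \<in> Sym_inf" "strict_mono_on {length xs<..} u'"
      "length xs < i" "\<And>k. k < i \<Longrightarrow> u k = u' k" for u u' i
  proof
    assume lt: "u i < u' i"
    obtain k where k: "u i = u' k" using Sym_inf_bij[OF t(2)] by (metis bij_pointE)
    have "\<not> k < i"
      using k t(5)[of k] Sym_inf_eq_iff[OF t(1), of i k] by auto
    moreover have "\<not> i \<le> k"
      using k lt t(3,4) unfolding strict_mono_on_def
      by (metis greaterThan_iff le_neq_implies_less less_imp_not_less order_less_le_trans)
    ultimately show False by simp
  qed
  show "w' = w"
  proof
    fix i show "w' i = w i"
    proof (induction i rule: less_induct)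
      case (less i)
      show ?case
      proof (cases "i \<le> length xs")
        case False
        then have "\<not> w i < w' i" "\<not> w' i < w i"
          using aux[of w w' i] aux[of w' w i] w' assms less by auto
        then show ?thesis by simp
      qed (use small in simp)
    qed
  qed
qed (use assms in auto)

text \<open>
  The value \<open>n + j + 1\<close> is a fixed point of \<open>u\<close>; the cycle moves it
  from its own position to position \<open>q\<close> and shifts the values in between by one
  place.
\<close>

lemma xi_eq:
  assumes u: "u \<in> Sym n" and q: "1 \<le> q" "q \<le> n + 1"
  shows "xi n q j u = u \<circ> word_perm (rev [q..<n + j + 1])"
  unfolding xi_def
proof (rule increasing_completion_eq)
  define c where "c = word_perm (rev [q..<n + j + 1])"
  have c: "c x = (if x = q then n + j + 1 else if q < x \<and> x \<le> n + j + 1 then x - 1 else x)" for x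
    unfolding c_def using q by (intro word_perm_rev_upt) auto
  show "u \<circ> word_perm (rev [q..<n + j + 1]) \<in> Sym_inf"
    using u q by (intro Sym_inf_comp word_perm_Sym_inf) (auto simp: Sym_inf_iff)
  let ?xs = "map u [1..<q] @ [n + j + 1] @ map u [q..<n + 1]"
  have len: "length ?xs = n + 1" using q by simp
  have sp: "[1..<n + 2] = [1..<q] @ [q] @ map Suc [q..<n + 1]"
    using q upt_add_eq_append[of 1 q "n + 2 - q"] upt_conv_Cons[of q "n + 2"]
    by (simp add: map_Suc_upt del: upt_Suc)
  have "map (u \<circ> c) [1..<n + 2] = ?xs"
    unfolding sp using Sym_fixes[OF u, of "n + j + 1"] q by (auto simp: c simp del: upt_Suc)
  then show "map (u \<circ> word_perm (rev [q..<n + j + 1])) [1..<length ?xs + 1] = ?xs" unfolding len c_def by simp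
  have "strict_mono_on {n + 1<..} (u \<circ> c)"
    using Sym_fixes[OF u] q by (intro strict_mono_onI) (auto simp: c)
  then show "strict_mono_on {length ?xs<..} (u \<circ> word_perm (rev [q..<n + j + 1]))" unfolding len c_def .
qed

lemma prepend_eq_xi: "1 \<le> n \<Longrightarrow> prepend n j u = xi (n - 1) 1 j u"
  by (simp add: prepend_def xi_def)

text \<open>
  The value that travels to the left is larger than all values it passes, so each letter of the
  cycle adds an inversion.
\<close>

lemma reduced_word_xi:
  assumes u: "u \<in> Sym n" "reduced_word u is" and q: "1 \<le> q" "q \<le> n + 1"
  shows "reduced_word (xi n q j u) (is @ rev [q..<n + j + 1])"
  unfolding xi_eq[OF u(1) q]
proof (rule reduced_word_append_cycle)
  fix x assume "q \<le> x" "x < n + j + 1"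
  then show "u x < u (n + j + 1)"
    using Sym_fixes[OF u(1), of "n + j + 1"] Sym_fixes[OF u(1), of x] Sym_le[OF u(1), of x]
    by (cases "x \<le> n") auto
qed (use assms in auto)

section \<open>Recursion for Grothendieck polynomials\<close>

interpretation demazure: braid_family demazure
  by unfold_locales (auto intro: demazure_commute demazure_braid)

lemma longest_Sym: "longest n \<in> Sym n"
proof -
  have "bij_betw (longest n) {1..n} {1..n}"
    by (rule bij_betw_byWitness[where f' = "longest n"]) (auto simp: longest_def)
  then show ?thesis
    by (auto simp: Sym_def longest_def intro!: bij_imp_permutes)
qed

lemma longest_longest [simp]: "longest n (longest n i) = i"
  by (auto simp: longest_def)

lemma inv_longest: "inv (longest n) = longest n"
  by (rule inv_equality) auto

abbreviation staircase :: "nat \<Rightarrow> zpoly" where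
  "staircase n \<equiv> (\<Prod>i=1..n. Var i ^ (n - i))"

text \<open>
  On \<open>(x\<^sub>i x\<^bsub>i+1\<^esub>)\<^sup>k x\<^sub>i\<close> the operator
  \<open>\<pi>\<^sub>i\<close> acts through \<open>\<pi>\<^sub>i x\<^sub>i = 1\<close>.
\<close>

lemma demazure_adjacent_powers:
  assumes A: "finite A" "i \<in> A" "Suc i \<in> A" and e: "e i = Suc (e (Suc i))"
  shows "demazure i (\<Prod>j\<in>A. Var j ^ e j) = (\<Prod>j\<in>A. Var j ^ (e(i := e (Suc i))) j)"
proof -
  define k where "k = e (Suc i)"
  define R where "R = (\<Prod>j\<in>A - {i} - {Suc i}. Var j ^ e j)"
  define c where "c = R * (Var i * Var (Suc i)) ^ k"
  have split: "(\<Prod>j\<in>A. Var j ^ f j) = (\<Prod>j\<in>A - {i} - {Suc i}. Var j ^ f j) * Var i ^ f i * Var (Suc i) ^ f (Suc i)" for f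
    using A by (subst prod.remove[of A i], simp, simp, subst prod.remove[of "A - {i}" "Suc i"]) (auto simp: mult_ac)
  have "s_act i R = R"
    unfolding R_def s_act.hom_prod by (intro prod.cong) (auto simp: transpose_def)
  then have c: "s_act i c = c" by (simp add: c_def mult_ac)
  have R': "(\<Prod>j\<in>A - {i} - {Suc i}. Var j ^ (e(i := e (Suc i))) j) = R"
    unfolding R_def by (intro prod.cong) auto
  have "demazure i (Var i) = 1"
    by (rule demazure_unique) (simp add: algebra_simps)
  moreover have "(\<Prod>j\<in>A. Var j ^ e j) = c * Var i"
    unfolding split[of e] R_def[symmetric] by (simp add: c_def k_def e power_mult_distrib mult_ac)
  moreover have "(\<Prod>j\<in>A. Var j ^ (e(i := e (Suc i))) j) = c"
    unfolding split R' by (simp add: c_def k_def power_mult_distrib mult_ac)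
  ultimately show ?thesis using demazure_invariant_mult[OF c, of "Var i"] by simp
qed

text \<open>
  Along a run of consecutively decreasing exponents each operator lowers one exponent and
  prepares the next pair. Stability, the polynomial of a one-row permutation and products
  \<open>x\<^sub>j x\<^sup>\<delta>\<close> are all obtained from this.
\<close>

lemma demazure_cycle_powers:
  assumes A: "finite A" "{a..b} \<subseteq> A" "a \<le> b"
    and e: "\<And>i. a \<le> i \<Longrightarrow> i < b \<Longrightarrow> e i = Suc (e (Suc i))"
  shows "foldr demazure (rev [a..<b]) (\<Prod>j\<in>A. Var j ^ e j) =
    (\<Prod>j\<in>A. Var j ^ (if a \<le> j \<and> j < b then e j - 1 else e j))"
  using A(3,2) e
proof (induction b rule: dec_induct)
  case base
  have "(if a \<le> j \<and> j < a then e j - 1 else e j) = e j" for j by auto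
  then show ?case by simp
next
  case (step b)
  let ?e = "\<lambda>j. if a \<le> j \<and> j < b then e j - 1 else e j"
  have "foldr demazure (rev [a..<Suc b]) (\<Prod>j\<in>A. Var j ^ e j) = demazure b (\<Prod>j\<in>A. Var j ^ ?e j)"
    using step by (simp add: subset_iff)
  also have "\<dots> = (\<Prod>j\<in>A. Var j ^ (?e(b := ?e (Suc b))) j)"
    using step A(1) by (intro demazure_adjacent_powers) (auto simp: subset_iff)
  also have "\<dots> = (\<Prod>j\<in>A. Var j ^ (if a \<le> j \<and> j < Suc b then e j - 1 else e j))"
    using step(5)[of b] step(1) by (intro prod.cong) (auto simp: less_Suc_eq)
  finally show ?case .
qed

lemma demazure_stair: "foldr demazure (rev [1..<Suc n]) (staircase (Suc n)) = staircase n"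
proof -
  have "foldr demazure (rev [1..<Suc n]) (staircase (Suc n)) =
    (\<Prod>j=1..Suc n. Var j ^ (if 1 \<le> j \<and> j < Suc n then Suc n - j - 1 else Suc n - j))"
    by (rule demazure_cycle_powers) auto
  also have "\<dots> = (\<Prod>j=1..Suc n. Var j ^ (n - j))"
    by (intro prod.cong) auto
  finally show ?thesis by simp
qed

lemma longest_Suc: "longest (Suc n) = longest n \<circ> word_perm (rev [1..<Suc n])"
proof
  fix x
  have "word_perm (rev [1..<Suc n]) x = (if x = 1 then Suc n else if 1 < x \<and> x \<le> Suc n then x - 1 else x)"
    by (rule word_perm_rev_upt) simp
  then show "longest (Suc n) x = (longest n \<circ> word_perm (rev [1..<Suc n])) x"
    by (auto simp: longest_def)
qed

lemma reduced_word_longest_Suc: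
  assumes v: "v \<in> Sym n" "reduced_word v is"
  shows "reduced_word (v \<circ> word_perm (rev [1..<Suc n])) (is @ rev [1..<Suc n])"
proof (rule reduced_word_append_cycle)
  fix x assume "1 \<le> x" "x < Suc n"
  then show "v x < v (Suc n)" using Sym_fixes[OF v(1), of "Suc n"] Sym_le[OF v(1), of x] by simp
qed (use v in auto)

lemma inv_count_longest: "inv_count (longest n) = (\<Sum>i=1..n. n - i)"
proof (induction n)
  case 0
  have "longest 0 = id" by (auto simp: longest_def)
  then have "inv_count (longest 0) = inv_count id" by (rule arg_cong)
  then show ?case by simp
next
  case (Suc n)
  obtain "is" where r: "reduced_word (longest n) is" using reduced_word_exists[OF longest_Sym] by metis
  have "inv_count (longest (Suc n)) = length (is @ rev [1..<Suc n])"
    using reduced_wordD(4)[OF reduced_word_longest_Suc[OF longest_Sym r]] by (simp add: longest_Suc)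
  also have "\<dots> = (\<Sum>i=1..n. n - i) + n" using reduced_wordD(4)[OF r] Suc by simp
  also have "\<dots> = (\<Sum>i=1..n. (n - i) + 1)" unfolding sum.distrib by simp
  also have "\<dots> = (\<Sum>i=1..n. Suc n - i)" by (intro sum.cong) auto
  finally show ?case by simp
qed

lemma groth_in_eq:
  assumes "reduced_word (inv w \<circ> longest n) is"
  shows "groth_in n w = foldr demazure is (staircase n)"
  unfolding groth_in_def demazure_perm_def
  by (rule demazure.foldr_reduced_word_unique[OF _ assms]) (rule someI[of "reduced_word _"], rule assms)

lemma inv_comp_longest_Sym: "w \<in> Sym n \<Longrightarrow> inv w \<circ> longest n \<in> Sym n"
  by (intro Sym_comp Sym_inv longest_Sym)

text \<open>
  Passing from \<open>n\<close> to \<open>n + 1\<close> multiplies \<open>w\<^sup>-\<^sup>1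
  \<omega>\<^sub>n\<close> on the right by \<open>s\<^sub>n \<cdots> s\<^sub>1\<close>, with
  lengths adding up, and these extra operators carry the staircase monomial of \<open>n +
  1\<close> to that of \<open>n\<close>.
\<close>

lemma groth_in_Suc:
  assumes "w \<in> Sym n"
  shows "groth_in (Suc n) w = groth_in n w"
proof -
  note v = inv_comp_longest_Sym[OF assms]
  obtain "is" where r: "reduced_word (inv w \<circ> longest n) is" using reduced_word_exists[OF v] by metis
  have "reduced_word (inv w \<circ> longest (Suc n)) (is @ rev [1..<Suc n])"
    using reduced_word_longest_Suc[OF v r] by (simp only: longest_Suc comp_assoc)
  then have "groth_in (Suc n) w = foldr demazure is (foldr demazure (rev [1..<Suc n]) (staircase (Suc n)))"
    by (simp only: groth_in_eq foldr_append comp_apply)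
  then show ?thesis by (simp only: demazure_stair groth_in_eq[OF r])
qed

lemma groth_eq_groth_in:
  assumes "w \<in> Sym n"
  shows "groth w = groth_in n w"
proof -
  define m where "m = (LEAST n. w \<in> Sym n)"
  have m: "w \<in> Sym m" "m \<le> n" using assms by (auto simp: m_def intro: LeastI Least_le)
  from m(2) have "groth_in n w = groth_in m w"
  proof (induction n rule: dec_induct)
    case (step k)
    then have "w \<in> Sym k" using Sym_mono[of m k] m(1) by auto
    then show ?case using groth_in_Suc step by simp
  qed simp
  then show ?thesis by (simp add: groth_def m_def)
qed

lemma groth_word:
  assumes "w \<in> Sym n"
  obtains "is" where "set is \<subseteq> {1..<n}" "reduced_word (inv w \<circ> longest n) is" "groth w = foldr demazure is (staircase n)"
  using reduced_word_exists[OF inv_comp_longest_Sym[OF assms]] groth_in_eq groth_eq_groth_in[OF assms] by metis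

lemma groth_longest: "groth (longest n) = staircase n"
proof -
  have "inv (longest n) \<circ> longest n = id" by (auto simp: inv_longest)
  then have "groth_in n (longest n) = foldr demazure [] (staircase n)"
    by (intro groth_in_eq) (simp add: reduced_word_id)
  then show ?thesis using groth_eq_groth_in[OF longest_Sym, of n] by simp
qed

lemma groth_id [simp]: "groth id = 1"
proof -
  have "longest 0 = id" by (auto simp: longest_def)
  then show ?thesis using groth_longest[of 0] by simp
qed

lemma demazure_groth_descent:
  assumes w: "w \<in> Sym_inf" and i: "1 \<le> i" and d: "w (Suc i) < w i"
  shows "demazure i (groth w) = groth (w \<circ> adj i)"
proof -
  obtain n where n: "w \<in> Sym n" "Suc i \<le> n" using Sym_inf_common[OF w w] by blast
  let ?v = "inv w \<circ> longest n"
  obtain "is" where r: "reduced_word ?v is" "groth w = foldr demazure is (staircase n)"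
    using groth_word[OF n(1)] by metis
  have bw: "bij w" by (rule Sym_inf_bij[OF w])
  have bl: "bij (longest n)" using longest_Sym Sym_inf_bij Sym_inf_iff by metis
  have "inv ?v = longest n \<circ> w"
    using bw bl by (simp add: o_inv_distrib bij_imp_bij_inv inv_longest inv_inv_eq)
  moreover have "w i \<le> n" "w (Suc i) \<le> n" "1 \<le> w (Suc i)"
    using Sym_le[OF n(1)] n(2) i Sym_inf_eq_iff[OF w, of "Suc i" 0] Sym_inf_zero[OF w] by auto
  ultimately have lt: "inv ?v i < inv ?v (Suc i)" using d by (auto simp: longest_def)
  have "inv (w \<circ> adj i) = adj i \<circ> inv w" using bw by (simp add: o_inv_distrib)
  then have e: "inv (w \<circ> adj i) \<circ> longest n = adj i \<circ> ?v" by (simp only: comp_assoc)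
  have "w \<circ> adj i \<in> Sym n" using n i by (intro Sym_comp Sym_adj) auto
  then have "groth (w \<circ> adj i) = groth_in n (w \<circ> adj i)" by (rule groth_eq_groth_in)
  also have "\<dots> = foldr demazure (i # is) (staircase n)"
    using reduced_word_Cons[OF r(1) i lt] by (intro groth_in_eq) (simp only: e)
  finally show ?thesis by (simp add: r(2))
qed

text \<open>
  Here \<open>G\<^sub>w\<close> is itself \<open>\<pi>\<^sub>i\<close> of another Grothendieck
  polynomial, and \<open>\<pi>\<^sub>i\<close> is idempotent.
\<close>

lemma demazure_groth_ascent:
  assumes w: "w \<in> Sym_inf" and i: "1 \<le> i" and d: "w i < w (Suc i)"
  shows "demazure i (groth w) = groth w"
proof -
  have "demazure i (groth (w \<circ> adj i)) = groth (w \<circ> adj i \<circ> adj i)"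
    using w i d by (intro demazure_groth_descent) (auto intro: Sym_inf_comp[OF w Sym_inf_adj[OF i]])
  then show ?thesis by (metis comp_adj_adj demazure_idem)
qed

lemma demazure_cycle_groth:
  assumes "a \<le> b" "1 \<le> a" "w \<in> Sym_inf" "\<And>x. a < x \<Longrightarrow> x \<le> b \<Longrightarrow> w x < w a"
  shows "foldr demazure (rev [a..<b]) (groth w) = groth (w \<circ> word_perm [a..<b])"
  using assms(1,4)
proof (induction b rule: dec_induct)
  case base
  then show ?case by simp
next
  case (step b)
  have "foldr demazure (rev [a..<Suc b]) (groth w) = demazure b (groth (w \<circ> word_perm [a..<b]))"
    using step by (simp add: comp_def)
  also have "\<dots> = groth (w \<circ> word_perm [a..<b] \<circ> adj b)"
  proof (rule demazure_groth_descent)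
    show "w \<circ> word_perm [a..<b] \<in> Sym_inf"
      using assms by (intro Sym_inf_comp word_perm_Sym_inf) auto
    show "(w \<circ> word_perm [a..<b]) (Suc b) < (w \<circ> word_perm [a..<b]) b"
      using step by (simp add: word_perm_upt)
  qed (use step assms in auto)
  also have "w \<circ> word_perm [a..<b] \<circ> adj b = w \<circ> word_perm [a..<Suc b]"
    using step by (simp add: comp_assoc)
  finally show ?case .
qed

section \<open>Degrees and exponents\<close>

definition total_degree :: "(nat \<Rightarrow>\<^sub>0 nat) \<Rightarrow> nat" where
  "total_degree m = (\<Sum>i\<in>Poly_Mapping.keys m. Poly_Mapping.lookup m i)"

lemma total_degree_superset:
  "finite A \<Longrightarrow> Poly_Mapping.keys m \<subseteq> A \<Longrightarrow> total_degree m = (\<Sum>i\<in>A. Poly_Mapping.lookup m i)"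
  unfolding total_degree_def by (intro sum.mono_neutral_left) (auto simp: in_keys_iff)

lemma total_degree_add: "total_degree (m + m') = total_degree m + total_degree m'"
  using keys_add[of m m']
  by (simp add: total_degree_superset[of "Poly_Mapping.keys m \<union> Poly_Mapping.keys m'"] lookup_add sum.distrib)

lemma total_degree_ddiff_exponent: "ddiff_exponent i m m' \<Longrightarrow> Suc (total_degree m') = total_degree m"
proof -
  assume d: "ddiff_exponent i m m'"
  define A where "A = Poly_Mapping.keys m \<union> Poly_Mapping.keys m' \<union> {i, Suc i}"
  have A: "finite A" "i \<in> A" "Suc i \<in> A - {i}" by (auto simp: A_def)
  have t: "total_degree x = Poly_Mapping.lookup x i + Poly_Mapping.lookup x (Suc i) +
      (\<Sum>j\<in>A - {i} - {Suc i}. Poly_Mapping.lookup x j)" if "Poly_Mapping.keys x \<subseteq> A" for x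
  proof -
    have "total_degree x = (\<Sum>j\<in>A. Poly_Mapping.lookup x j)" using that A by (intro total_degree_superset) auto
    then show ?thesis
      using sum.remove[OF A(1,2), of "Poly_Mapping.lookup x"]
        sum.remove[OF _ A(3), of "Poly_Mapping.lookup x"] A(1) by simp
  qed
  have eq: "(\<Sum>j\<in>A - {i} - {Suc i}. Poly_Mapping.lookup m j) = (\<Sum>j\<in>A - {i} - {Suc i}. Poly_Mapping.lookup m' j)"
    using d by (intro sum.cong) (auto simp: ddiff_exponent_def)
  have k: "Poly_Mapping.keys m \<subseteq> A" "Poly_Mapping.keys m' \<subseteq> A" by (auto simp: A_def)
  have "Suc (Poly_Mapping.lookup m' i + Poly_Mapping.lookup m' (Suc i)) =
      Poly_Mapping.lookup m i + Poly_Mapping.lookup m (Suc i)"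
    using d by (simp add: ddiff_exponent_def)
  then show ?thesis unfolding t[OF k(1)] t[OF k(2)] eq by linarith
qed

text \<open>
  Order of vanishing at the origin. It is needed only to see that \<open>G\<^sub>w\<close> has
  no constant term unless \<open>w\<close> is the identity.
\<close>

definition order_ge :: "nat \<Rightarrow> zpoly \<Rightarrow> bool" where
  "order_ge d f \<longleftrightarrow> (\<forall>m\<in>Poly_Mapping.keys f. d \<le> total_degree m)"

lemma order_ge_add: "order_ge d f \<Longrightarrow> order_ge d g \<Longrightarrow> order_ge d (f + g)"
  using keys_add[of f g] by (auto simp: order_ge_def)

lemma order_ge_mult: "order_ge d f \<Longrightarrow> order_ge d (g * f)"
  using keys_mult[of g f] by (fastforce simp: order_ge_def total_degree_add)

lemma order_ge_mono: "order_ge d f \<Longrightarrow> d' \<le> d \<Longrightarrow> order_ge d' f"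
  by (auto simp: order_ge_def)

lemma order_ge_demazure: "order_ge (Suc d) f \<Longrightarrow> order_ge d (demazure i f)"
  unfolding demazure_ddiff
proof (rule order_ge_add[OF _ order_ge_mult])
  assume f: "order_ge (Suc d) f"
  then show "order_ge d f" by (rule order_ge_mono) simp
  show "order_ge d (ddiff i f)"
    unfolding order_ge_def
  proof
    fix m' assume "m' \<in> Poly_Mapping.keys (ddiff i f)"
    then obtain m where "m \<in> Poly_Mapping.keys f" "ddiff_exponent i m m'" by (rule keys_ddiff)
    then show "d \<le> total_degree m'" using f total_degree_ddiff_exponent[of i m m'] by (auto simp: order_ge_def)
  qed
qed

lemma order_ge_foldr_demazure:
  "order_ge (d + length is) f \<Longrightarrow> order_ge d (foldr demazure is f)"
proof (induction "is" arbitrary: d)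
  case (Cons i "is")
  then show ?case using order_ge_demazure Cons.IH[of "Suc d"] by simp
qed simp

lemma prod_Var_powers:
  "(\<Prod>i\<in>A. Var (g i) ^ e i) = monomial (\<Sum>i\<in>A. Poly_Mapping.single (g i) (e i))"
  by (induction A rule: infinite_finite_induct) (auto simp: Var_power monomial_add[symmetric])

abbreviation const_term :: "zpoly \<Rightarrow> int" where
  "const_term \<equiv> substitute (\<lambda>_. 0)"

lemma const_term_eq_0: "order_ge 1 f \<Longrightarrow> const_term f = 0"
  unfolding substitute_def
proof (intro sum.neutral ballI)
  fix m assume "order_ge 1 f" "m \<in> Poly_Mapping.keys f"
  then have "1 \<le> total_degree m" by (auto simp: order_ge_def)
  then obtain i where "i \<in> Poly_Mapping.keys m"
    unfolding total_degree_def by (metis all_not_in_conv not_one_le_zero sum.empty)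
  then have "(\<Prod>i\<in>Poly_Mapping.keys m. (0::int) ^ Poly_Mapping.lookup m i) = 0"
    by (intro prod_zero bexI[of _ i]) (auto simp: in_keys_iff)
  then show "of_int (Poly_Mapping.lookup f m) * (\<Prod>i\<in>Poly_Mapping.keys m. (0::int) ^ Poly_Mapping.lookup m i) = 0"
    by simp
qed

text \<open>
  \<open>G\<^sub>w\<close> arises from a monomial whose degree is the length of
  \<open>\<omega>\<^sub>n\<close> by as many operators as \<open>w\<^sup>-\<^sup>1
  \<omega>\<^sub>n\<close> has inversions, and each operator lowers the order of vanishing by at
  most one. For \<open>w \<noteq> id\<close> there are fewer operators than the degree.
\<close>

lemma const_term_groth:
  assumes w: "w \<in> Sym_inf"
  shows "const_term (groth w) = (if w = id then 1 else 0)"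
proof (cases "w = id")
  case False
  then obtain i where i: "1 \<le> i" "w (Suc i) < w i"
    using no_descent_imp_id[OF w] adj_cases[OF w] by metis
  obtain n where n: "w \<in> Sym n" "Suc i \<le> n" using Sym_inf_common[OF w w] by blast
  let ?v = "inv w \<circ> longest n"
  obtain "is" where r: "reduced_word ?v is" "groth w = foldr demazure is (staircase n)"
    using groth_word[OF n(1)] by metis
  have v: "?v \<in> Sym n" by (rule inv_comp_longest_Sym[OF n(1)])
  \<comment> \<open>The inclusion is strict: a descent \<open>i\<close> of \<open>w\<close> gives a pair that \<open>w\<^sup>-\<^sup>1 \<omega>\<^sub>n\<close> maps to \<open>(i, i + 1)\<close>.\<close>
  have "inversions ?v \<subset> inversions (longest n)"
  proof
    show "inversions ?v \<subseteq> inversions (longest n)"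
    proof (clarsimp simp only: inversions_def)
      fix a b assume ab: "a < b" "?v b < ?v a"
      have "a \<noteq> 0" using ab(2) Sym_inf_zero[OF reduced_wordD(3)[OF r(1)]] by (cases "a = 0") auto
      moreover have "b \<le> n"
        using ab Sym_fixes[OF v, of b] Sym_fixes[OF v, of a] Sym_le[OF v, of a] by (cases "a \<le> n"; cases "b \<le> n") auto
      ultimately show "longest n b < longest n a" using ab(1) by (auto simp: longest_def)
    qed
    have le: "w i \<le> n" "w (Suc i) \<le> n" "1 \<le> w (Suc i)"
      using Sym_le[OF n(1)] n(2) i Sym_inf_eq_iff[OF w, of "Suc i" 0] Sym_inf_zero[OF w] by auto
    have "(longest n (w i), longest n (w (Suc i))) \<in> inversions (longest n)"
      using le i by (auto simp: inversions_def) (auto simp: longest_def)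
    moreover have "(longest n (w i), longest n (w (Suc i))) \<notin> inversions ?v"
      using Sym_inf_bij[OF w] by (auto simp: inversions_def bij_is_inj)
    ultimately show "inversions ?v \<noteq> inversions (longest n)" by auto
  qed
  then have "inv_count ?v < inv_count (longest n)"
    unfolding inv_count_def using longest_Sym Sym_inf_iff
    by (intro psubset_card_mono finite_inversions) auto
  then have len: "1 + length is \<le> (\<Sum>i=1..n. n - i)"
    using reduced_wordD(4)[OF r(1)] by (simp add: inv_count_longest)
  have total_sum: "total_degree (\<Sum>i\<in>A. Poly_Mapping.single i (e i)) = sum e A" for A e
    by (induction A rule: infinite_finite_induct) (auto simp: total_degree_add, auto simp: total_degree_def)
  have st: "order_ge (\<Sum>i=1..n. n - i) (staircase n)"
    by (simp add: prod_Var_powers[of "\<lambda>i. i"] order_ge_def total_sum)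
  have "order_ge 1 (groth w)"
    unfolding r(2) by (rule order_ge_foldr_demazure[OF order_ge_mono[OF st len]])
  then show ?thesis using False const_term_eq_0 by simp
qed simp

definition bounded_by :: "(nat \<Rightarrow> nat) \<Rightarrow> zpoly \<Rightarrow> bool" where
  "bounded_by b f \<longleftrightarrow> (\<forall>m\<in>Poly_Mapping.keys f. \<forall>i. Poly_Mapping.lookup m i \<le> b i)"

lemma bounded_by_add: "bounded_by b f \<Longrightarrow> bounded_by b g \<Longrightarrow> bounded_by b (f + g)"
  using keys_add[of f g] unfolding bounded_by_def by blast

lemma bounded_by_mono: "bounded_by b f \<Longrightarrow> (\<And>i. b i \<le> b' i) \<Longrightarrow> bounded_by b' f"
  unfolding bounded_by_def by (meson order_trans)

lemma bounded_by_uminus: "bounded_by b f \<Longrightarrow> bounded_by b (- f)"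
  by (simp add: bounded_by_def)

lemma bounded_by_Var_mult: "bounded_by b f \<Longrightarrow> bounded_by (b(i := Suc (b i))) (Var i * f)"
  unfolding bounded_by_def
proof (intro ballI allI)
  fix m k assume f: "\<forall>m\<in>Poly_Mapping.keys f. \<forall>i. Poly_Mapping.lookup m i \<le> b i"
    and "m \<in> Poly_Mapping.keys (Var i * f)"
  then obtain m' where "m = Poly_Mapping.single i 1 + m'" "m' \<in> Poly_Mapping.keys f"
    using keys_mult[of "Var i" f] by (auto simp: Var_def)
  then show "Poly_Mapping.lookup m k \<le> (b(i := Suc (b i))) k"
    using f by (auto simp: lookup_add lookup_single when_def)
qed

lemma bounded_by_ddiff:
  fixes i :: nat
  assumes f: "bounded_by b f"
  defines "M \<equiv> max (b i) (b (Suc i))"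
  shows "bounded_by (b(i := M - 1, Suc i := M - 1)) (ddiff i f)"
  unfolding bounded_by_def
proof (intro ballI allI)
  fix m' k assume "m' \<in> Poly_Mapping.keys (ddiff i f)"
  then obtain m where m: "m \<in> Poly_Mapping.keys f" "ddiff_exponent i m m'" by (rule keys_ddiff)
  have "Poly_Mapping.lookup m j \<le> b j" for j using f m(1) by (auto simp: bounded_by_def)
  from this[of i] this[of "Suc i"] this[of k]
  show "Poly_Mapping.lookup m' k \<le> (b(i := M - 1, Suc i := M - 1)) k"
    using m(2) unfolding ddiff_exponent_def M_def by (cases "k = i"; cases "k = Suc i") auto
qed

lemma bounded_by_ddiff_eq_0:
  assumes f: "bounded_by b f" and b: "b i = 0" "b (Suc i) = 0"
  shows "ddiff i f = 0"
proof -
  have "Poly_Mapping.keys (ddiff i f) = {}"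
  proof (rule ccontr)
    assume "\<not> ?thesis"
    then obtain m' where "m' \<in> Poly_Mapping.keys (ddiff i f)" by blast
    then obtain m where m: "m \<in> Poly_Mapping.keys f" "ddiff_exponent i m m'" by (rule keys_ddiff)
    then have "Poly_Mapping.lookup m i \<le> 0" "Poly_Mapping.lookup m (Suc i) \<le> 0"
      using f b unfolding bounded_by_def by metis+
    then show False using m(2) by (simp add: ddiff_exponent_def)
  qed
  then show ?thesis by simp
qed

text \<open>
  A Grothendieck polynomial of \<open>S\<^sub>n\<close> obeys these bounds, and
  \<open>\<pi>\<^sub>i\<close> preserves them. The bound \<open>0\<close> at index
  \<open>0\<close> excludes the variable \<open>x\<^sub>0\<close>.
\<close>

definition stair_bound :: "nat \<Rightarrow> nat \<Rightarrow> nat" where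
  "stair_bound n i = (if i = 0 then 0 else n - i)"

text \<open>
  The operator \<open>\<pi>\<^sub>i - 1\<close>: it kills \<open>G\<^sub>w\<close> if
  \<open>i\<close> is an ascent of \<open>w\<close> and yields \<open>G\<^bsub>w s_i\<^esub> -
  G\<^sub>w\<close> if \<open>i\<close> is a descent.
\<close>

definition hat :: "nat \<Rightarrow> zpoly \<Rightarrow> zpoly" where
  "hat i f = (1 - Var i) * ddiff i f"

lemma hat_demazure: "hat i f = demazure i f - f"
  by (simp add: hat_def demazure_ddiff)

lemma hat_zero [simp]: "hat i 0 = 0"
  by (simp add: hat_def)

lemma hat_add: "hat i (f + g) = hat i f + hat i g"
  by (simp add: hat_def ddiff_add distrib_left)

lemma hat_invariant_mult: "s_act i c = c \<Longrightarrow> hat i (c * f) = c * hat i f"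
  by (simp add: hat_def ddiff_invariant_mult mult_ac)

lemma foldr_hat_zero [simp]: "foldr hat is 0 = 0"
  by (induction "is") auto

lemma foldr_hat_add: "foldr hat is (f + g) = foldr hat is f + foldr hat is g"
  by (induction "is") (auto simp: hat_add)

lemma foldr_hat_invariant_mult:
  "(\<And>i. i \<in> set is \<Longrightarrow> s_act i c = c) \<Longrightarrow> foldr hat is (c * f) = c * foldr hat is f"
  by (induction "is") (auto simp: hat_invariant_mult)

text \<open>
  The divided difference lowers the exponents of \<open>x\<^sub>i\<close> and
  \<open>x\<^bsub>i+1\<^esub>\<close> to at most \<open>n - i - 1\<close>; multiplication by
  \<open>1 - x\<^sub>i\<close> then uses the one unit of room at \<open>x\<^sub>i\<close>.
\<close>

lemma hat_stair_bound:
  assumes f: "bounded_by (stair_bound n) f" and i: "1 \<le> i"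
  shows "bounded_by (stair_bound n) (hat i f)" "n \<le> i \<Longrightarrow> hat i f = 0"
proof -
  show *: "hat i f = 0" if "n \<le> i"
    using bounded_by_ddiff_eq_0[OF f, of i] that i by (simp add: stair_bound_def hat_def)
  show "bounded_by (stair_bound n) (hat i f)"
  proof (cases "n \<le> i")
    case False
    let ?b = "(stair_bound n)(i := n - Suc i, Suc i := n - Suc i)"
    have *: "max (stair_bound n i) (stair_bound n (Suc i)) = n - i" using i by (auto simp: stair_bound_def)
    have d: "bounded_by ?b (ddiff i f)" using bounded_by_ddiff[OF f, of i] unfolding * by simp
    have "bounded_by (stair_bound n) (ddiff i f)"
      by (rule bounded_by_mono[OF d]) (use i in \<open>auto simp: stair_bound_def\<close>)
    moreover have "bounded_by (stair_bound n) (- (Var i * ddiff i f))"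
      using bounded_by_Var_mult[OF d, of i]
      by (intro bounded_by_uminus, elim bounded_by_mono) (use False i in \<open>auto simp: stair_bound_def\<close>)
    ultimately have "bounded_by (stair_bound n) (ddiff i f + - (Var i * ddiff i f))"
      by (rule bounded_by_add)
    then show ?thesis by (simp add: hat_def algebra_simps)
  qed (use * in \<open>simp add: bounded_by_def\<close>)
qed

text \<open>
  So on staircase polynomials only the coordinates indexed by \<open>S\<^sub>n\<close> can be
  non-zero: a reduced word of any other permutation has a letter \<open>\<ge> n\<close>.
\<close>

lemma foldr_hat_stair_bound:
  assumes "bounded_by (stair_bound n) f" "set is \<subseteq> {1..}"
  shows "bounded_by (stair_bound n) (foldr hat is f)"
    and "\<not> set is \<subseteq> {1..<n} \<Longrightarrow> foldr hat is f = 0"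
proof -
  have "bounded_by (stair_bound n) (foldr hat is f) \<and> (\<not> set is \<subseteq> {1..<n} \<longrightarrow> foldr hat is f = 0)"
    using assms
  proof (induction "is")
    case (Cons i "is")
    then show ?case using hat_stair_bound[of n "foldr hat is f" i] by auto
  qed simp
  then show "bounded_by (stair_bound n) (foldr hat is f)"
    and "\<not> set is \<subseteq> {1..<n} \<Longrightarrow> foldr hat is f = 0" by auto
qed

lemma stair_bound_demazure:
  "bounded_by (stair_bound n) f \<Longrightarrow> 1 \<le> i \<Longrightarrow> bounded_by (stair_bound n) (demazure i f)"
  using bounded_by_add[OF _ hat_stair_bound(1)] by (fastforce simp: demazure_ddiff hat_def)

lemma stair_bound_groth:
  assumes "w \<in> Sym n"
  shows "bounded_by (stair_bound n) (groth w)"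
proof -
  obtain "is" where r: "set is \<subseteq> {1..<n}" "groth w = foldr demazure is (staircase n)"
    using groth_word[OF assms] by metis
  have "Poly_Mapping.lookup (\<Sum>i=1..n. Poly_Mapping.single i (n - i)) k \<le> stair_bound n k" for k
    by (simp add: lookup_sum lookup_single when_def stair_bound_def)
  then have "bounded_by (stair_bound n) (staircase n)"
    by (simp add: prod_Var_powers[of "\<lambda>i. i"] bounded_by_def)
  then show ?thesis
    unfolding r(2) using r(1) by (induction "is") (auto simp: stair_bound_demazure)
qed

section \<open>The Grothendieck basis\<close>

text \<open>
  Coordinates by operators. Removing the last letter \<open>i\<close> of the word of
  \<open>v\<close> replaces the coordinate at \<open>v\<close> by the difference of the
  coordinates at \<open>v s\<^sub>i\<close> of \<open>\<pi>\<^sub>i f\<close> and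
  \<open>f\<close>, which for \<open>f = G\<^sub>w\<close> agrees with the recursion because
  \<open>i\<close> is a descent of \<open>v\<close> and an ascent of \<open>v s\<^sub>i\<close>.
\<close>

lemma const_term_hat_groth:
  assumes "reduced_word v is" "w \<in> Sym_inf"
  shows "const_term (foldr hat is (groth w)) = (if w = v then 1 else 0)"
  using assms
proof (induction "is" arbitrary: v w rule: rev_induct)
  case Nil
  then have v: "v = id" using reduced_wordD(2)[of v "[]"] by (simp only: word_perm_Nil)
  have e: "foldr hat [] (groth w) = groth w" by simp
  show ?case unfolding v e by (rule const_term_groth[OF Nil(2)])
next
  case (snoc i "is")
  note r = reduced_word_snocD[OF snoc(2)]
  have wi: "w \<circ> adj i \<in> Sym_inf" by (rule Sym_inf_comp[OF snoc(3) Sym_inf_adj[OF r(1)]])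
  have eq: "w \<circ> adj i = v \<circ> adj i \<longleftrightarrow> w = v" by (metis comp_adj_adj)
  show ?case
  proof (cases rule: adj_cases[OF snoc(3), of i])
    case 1
    then have "hat i (groth w) = 0"
      using demazure_groth_ascent[OF snoc(3) r(1)] by (simp add: hat_demazure)
    then show ?thesis using 1 r(3) by auto
  next
    case 2
    then have e: "groth (w \<circ> adj i) = hat i (groth w) + groth w"
      using demazure_groth_descent[OF snoc(3) r(1)] by (simp add: hat_demazure)
    have "w \<noteq> v \<circ> adj i" using 2 r(3) by (auto simp: transpose_def)
    then have "const_term (foldr hat is (groth w)) = 0" using snoc.IH[OF r(2) snoc(3)] by (simp only: if_False)
    moreover have "const_term (foldr hat is (groth (w \<circ> adj i))) = (if w = v then 1 else 0)"
      using snoc.IH[OF r(2) wi] by (simp only: eq)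
    ultimately show ?thesis unfolding e foldr_hat_add by simp
  qed
qed

definition groth_comb :: "((nat \<Rightarrow> nat) \<Rightarrow>\<^sub>0 int) \<Rightarrow> zpoly" where
  "groth_comb c = (\<Sum>w\<in>Poly_Mapping.keys c. of_int (Poly_Mapping.lookup c w) * groth w)"

lemma groth_comb_superset:
  "finite A \<Longrightarrow> Poly_Mapping.keys c \<subseteq> A \<Longrightarrow>
    groth_comb c = (\<Sum>w\<in>A. of_int (Poly_Mapping.lookup c w) * groth w)"
  unfolding groth_comb_def by (intro sum.mono_neutral_left) (auto simp: in_keys_iff)

lemma groth_comb_add: "groth_comb (c + d) = groth_comb c + groth_comb d"
  using keys_add[of c d]
  by (simp add: groth_comb_superset[of "Poly_Mapping.keys c \<union> Poly_Mapping.keys d"] lookup_add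
      ring_distribs sum.distrib)

lemma groth_comb_uminus: "groth_comb (- c) = - groth_comb c"
  by (simp add: groth_comb_def sum_negf)

lemma const_term_hat_sum:
  "const_term (foldr hat is (\<Sum>w\<in>A. of_int (c w) * g w)) = (\<Sum>w\<in>A. c w * const_term (foldr hat is (g w)))"
proof (induction A rule: infinite_finite_induct)
  case (insert x A)
  then show ?case by (simp add: foldr_hat_add foldr_hat_invariant_mult del: single_of_int)
qed auto

lemma groth_comb_coeff:
  assumes "reduced_word v is" "Poly_Mapping.keys c \<subseteq> Sym_inf"
  shows "const_term (foldr hat is (groth_comb c)) = Poly_Mapping.lookup c v"
proof -
  have "const_term (foldr hat is (groth_comb c)) =
      (\<Sum>w\<in>Poly_Mapping.keys c. Poly_Mapping.lookup c w * const_term (foldr hat is (groth w)))"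
    by (simp only: groth_comb_def const_term_hat_sum)
  also have "\<dots> = (\<Sum>w\<in>Poly_Mapping.keys c. if w = v then Poly_Mapping.lookup c v else 0)"
    using assms by (intro sum.cong) (auto simp: const_term_hat_groth)
  also have "\<dots> = Poly_Mapping.lookup c v" by (simp add: in_keys_iff)
  finally show ?thesis .
qed

text \<open>
  The additive group spanned by the Grothendieck polynomials, presented by closure rules so that
  stability under operators is an induction on generators.
\<close>

inductive_set groth_span :: "zpoly set" where
  base: "w \<in> Sym_inf \<Longrightarrow> groth w \<in> groth_span"
| zero: "0 \<in> groth_span"
| add: "f \<in> groth_span \<Longrightarrow> g \<in> groth_span \<Longrightarrow> f + g \<in> groth_span"
| uminus: "f \<in> groth_span \<Longrightarrow> - f \<in> groth_span"

lemma groth_span_minus: "f \<in> groth_span \<Longrightarrow> g \<in> groth_span \<Longrightarrow> f - g \<in> groth_span"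
  using groth_span.add[OF _ groth_span.uminus, of f g] by simp

lemma groth_span_sum: "(\<And>x. x \<in> A \<Longrightarrow> f x \<in> groth_span) \<Longrightarrow> sum f A \<in> groth_span"
  by (induction A rule: infinite_finite_induct) (auto intro: groth_span.intros)

lemma groth_span_comb:
  assumes "f \<in> groth_span"
  obtains c where "Poly_Mapping.keys c \<subseteq> Sym_inf" "f = groth_comb c"
proof -
  have "\<exists>c. Poly_Mapping.keys c \<subseteq> Sym_inf \<and> f = groth_comb c"
    using assms
  proof induction
    case (base w)
    then show ?case by (intro exI[of _ "Poly_Mapping.single w 1"]) (simp add: groth_comb_def)
  next
    case zero
    then show ?case by (intro exI[of _ 0]) (simp add: groth_comb_def)
  next
    case (add f g)
    then obtain c d where "Poly_Mapping.keys c \<subseteq> Sym_inf" "f = groth_comb c"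
      "Poly_Mapping.keys d \<subseteq> Sym_inf" "g = groth_comb d" by blast
    then show ?case using keys_add[of c d]
      by (intro exI[of _ "c + d"]) (auto simp: groth_comb_add)
  next
    case (uminus f)
    then obtain c where "Poly_Mapping.keys c \<subseteq> Sym_inf" "f = groth_comb c" by blast
    then show ?case by (intro exI[of _ "- c"]) (auto simp: groth_comb_uminus)
  qed
  then show ?thesis using that by blast
qed

lemma demazure_uminus: "demazure i (- f) = - demazure i f"
  using demazure_add[of i f "- f"] by (simp add: eq_neg_iff_add_eq_0 add.commute)

lemma groth_span_demazure: "f \<in> groth_span \<Longrightarrow> 1 \<le> i \<Longrightarrow> demazure i f \<in> groth_span"
proof (induction rule: groth_span.induct)
  case (base w)
  show ?case
    by (rule adj_cases[OF base(1), of i])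
      (use base groth_span.base[OF base(1)] groth_span.base[OF Sym_inf_comp[OF base(1) Sym_inf_adj[OF base(2)]]]
        in \<open>simp_all only: demazure_groth_ascent demazure_groth_descent\<close>)
qed (auto simp: demazure_add demazure_uminus intro: groth_span.intros)

text \<open>
  These commutation rules push a variable through \<open>\<pi>\<^sub>i\<close>. With them,
  closure of the span under multiplication by variables descends from
  \<open>G\<^bsub>\<omega>_n\<^esub>\<close> to all \<open>G\<^sub>w\<close>.
\<close>

lemma Var_mult_demazure:
  "Var (Suc i) * demazure i f = demazure i (Var i * f) - f + Var (Suc i) * f"
  "Var i * demazure i f = demazure i (Var (Suc i) * f) + f - Var (Suc i) * f"
proof -
  have 1: "ddiff i (Var i) = 1" by (rule ddiff_unique) simp
  have 2: "ddiff i (Var (Suc i)) = - 1" by (rule ddiff_unique) simp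
  show "Var (Suc i) * demazure i f = demazure i (Var i * f) - f + Var (Suc i) * f"
    unfolding demazure_ddiff ddiff_Leibniz 1 by (simp add: algebra_simps)
  show "Var i * demazure i f = demazure i (Var (Suc i) * f) + f - Var (Suc i) * f"
    unfolding demazure_ddiff ddiff_Leibniz 2 by (simp add: algebra_simps)
qed

text \<open>
  The exponents of \<open>x\<^sub>j x\<^sup>\<delta>\<close> still decrease weakly. They are
  those of the next larger staircase with every exponent except the \<open>j\<close>-th lowered
  by one, which two runs of operators achieve, one on each side of \<open>j\<close>.
\<close>

lemma Var_mult_stair:
  assumes j: "1 \<le> j" "j \<le> n"
  shows "Var j * staircase n \<in> groth_span"
proof -
  have fold: "foldr demazure is f \<in> groth_span" if "set is \<subseteq> {1..}" "f \<in> groth_span" for "is" f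
    using that by (induction "is") (auto intro: groth_span_demazure)
  \<comment> \<open>The exponents after the first run, which stops in front of \<open>j\<close>.\<close>
  define e where "e i = (if 1 \<le> i \<and> i < j then n - i else Suc n - i)" for i
  have 1: "foldr demazure (rev [1..<j]) (staircase (Suc n)) =
      (\<Prod>i=1..Suc n. Var i ^ (if 1 \<le> i \<and> i < j then Suc n - i - 1 else Suc n - i))"
    using j by (intro demazure_cycle_powers) auto
  have 2: "foldr demazure (rev [Suc j..<Suc n]) (\<Prod>i=1..Suc n. Var i ^ e i) =
      (\<Prod>i=1..Suc n. Var i ^ (if Suc j \<le> i \<and> i < Suc n then e i - 1 else e i))"
    using j by (intro demazure_cycle_powers) (auto simp: e_def)
  have "staircase (Suc n) \<in> groth_span"
    using groth_span.base[of "longest (Suc n)"] longest_Sym Sym_inf_iff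
    by (auto simp only: groth_longest)
  then have "foldr demazure (rev [Suc j..<Suc n]) (foldr demazure (rev [1..<j]) (staircase (Suc n))) \<in> groth_span"
    by (intro fold) auto
  also have "foldr demazure (rev [1..<j]) (staircase (Suc n)) = (\<Prod>i=1..Suc n. Var i ^ e i)"
    unfolding 1 by (intro prod.cong) (auto simp: e_def)
  also note 2
  also have "(\<Prod>i=1..Suc n. Var i ^ (if Suc j \<le> i \<and> i < Suc n then e i - 1 else e i)) =
      (\<Prod>i=1..Suc n. Var i ^ (n - i) * (if i = j then Var i else 1))"
    using j by (intro prod.cong) (auto simp: e_def Suc_diff_le)
  also have "\<dots> = staircase n * (\<Prod>i=1..Suc n. if i = j then Var i else 1)"
    by (simp add: prod.distrib)
  also have "(\<Prod>i=1..Suc n. if i = j then Var i else 1) = Var j"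
    using j by (subst prod.delta) auto
  finally show ?thesis by (simp add: mult.commute)
qed

lemma Var_mult_groth_span:
  assumes "f \<in> groth_span" "1 \<le> j"
  shows "Var j * f \<in> groth_span"
  using assms(1)
proof induction
  case (base w)
  obtain n where n: "w \<in> Sym n" "j \<le> n" using Sym_inf_common[OF base base] by blast
  obtain "is" where r: "set is \<subseteq> {1..<n}" "groth w = foldr demazure is (staircase n)"
    using groth_word[OF n(1)] by metis
  have "foldr demazure is (staircase n) \<in> groth_span \<and>
      (\<forall>j\<in>{1..n}. Var j * foldr demazure is (staircase n) \<in> groth_span)"
    using r(1)
  proof (induction "is")
    case Nil
    have "staircase n \<in> groth_span"
      using groth_span.base[of "longest n"] longest_Sym Sym_inf_iff by (auto simp only: groth_longest)
    then show ?case using Var_mult_stair by auto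
  next
    case (Cons i "is")
    define f where "f = foldr demazure is (staircase n)"
    have i: "1 \<le> i" "Suc i \<le> n" using Cons(2) by auto
    have f: "f \<in> groth_span" "\<And>j. 1 \<le> j \<Longrightarrow> j \<le> n \<Longrightarrow> Var j * f \<in> groth_span"
      using Cons by (auto simp: f_def)
    have "Var j * demazure i f \<in> groth_span" if j: "1 \<le> j" "j \<le> n" for j
    proof -
      consider "j = i" | "j = Suc i" | "j \<noteq> i" "j \<noteq> Suc i" by blast
      then show ?thesis
      proof cases
        case 1
        then show ?thesis unfolding 1 Var_mult_demazure using f i
          by (intro groth_span_minus groth_span.add groth_span_demazure) auto
      next
        case 2
        then show ?thesis unfolding 2 Var_mult_demazure using f i
          by (intro groth_span_minus groth_span.add groth_span_demazure) auto
      next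
        case 3
        then have "Var j * demazure i f = demazure i (Var j * f)"
          by (subst demazure_invariant_mult) (auto simp: transpose_def)
        then show ?thesis using f i j by (simp add: groth_span_demazure)
      qed
    qed
    then show ?case
      using groth_span_demazure[OF f(1) i(1)] unfolding f_def foldr.simps comp_apply by auto
  qed
  then show ?case using n assms(2) r(2) by simp
qed (auto simp: distrib_left intro: groth_span.intros)

text \<open>
  The span contains \<open>1\<close> and is closed under multiplication by \<open>x\<^sub>1,
  x\<^sub>2, \<dots>\<close>, hence contains every polynomial in these variables.
\<close>

lemma groth_spanI:
  assumes "\<And>m. m \<in> Poly_Mapping.keys f \<Longrightarrow> Poly_Mapping.lookup m 0 = 0"
  shows "f \<in> groth_span"
proof -
  have 1: "1 \<in> groth_span" using groth_span.base[of id] Sym_id Sym_inf_iff by (auto simp only: groth_id)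
  have nat: "of_nat k * g \<in> groth_span" if "g \<in> groth_span" for k g
    by (induction k) (auto simp: that distrib_right intro: groth_span.intros)
  have int: "of_int k * g \<in> groth_span" if "g \<in> groth_span" for k g
  proof (cases k rule: int_cases2)
    case (nonneg n)
    then show ?thesis using nat[OF that, of n] by (simp only: of_int_of_nat_eq)
  next
    case (nonpos n)
    then show ?thesis using groth_span.uminus[OF nat[OF that, of n]]
      by (simp only: of_int_minus of_int_of_nat_eq mult_minus_left)
  qed
  have pow: "Var j ^ k * g \<in> groth_span" if "1 \<le> j" "g \<in> groth_span" for j k g
    using that by (induction k) (auto simp: mult.assoc Var_mult_groth_span)
  have prod: "(\<Prod>j\<in>A. Var j ^ e j) \<in> groth_span" if "A \<subseteq> {1..}" for A e
    using that by (induction A rule: infinite_finite_induct) (auto simp: 1 pow)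
  have "monomial m \<in> groth_span" if "m \<in> Poly_Mapping.keys f" for m
    unfolding monomial_value_Var[symmetric] monomial_value_def using assms[OF that]
    by (intro prod) (auto simp: in_keys_iff Suc_le_eq intro!: Nat.gr0I)
  then have "(\<Sum>m\<in>Poly_Mapping.keys f. of_int (Poly_Mapping.lookup f m) * monomial m) \<in> groth_span"
    by (intro groth_span_sum int)
  then show ?thesis using zpoly_expansion[of "Poly_Mapping.keys f" f] by simp
qed

text \<open>
  Spanning gives existence of the coefficient family in the definition of the structure
  constants, the coordinate functionals give uniqueness and the value.
\<close>

lemma struct_const_eq:
  assumes w: "w \<in> Sym_inf" "r \<in> Sym_inf" and v: "reduced_word v is"
  shows "struct_const w r v = const_term (foldr hat is (groth w * groth r))"
proof -
  have z: "Poly_Mapping.lookup m 0 = 0" if mu: "m \<in> Poly_Mapping.keys (groth u)" "u \<in> Sym_inf" for m u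
  proof -
    obtain n where "u \<in> Sym n" using mu(2) by (auto simp: Sym_inf_iff)
    then have "Poly_Mapping.lookup m 0 \<le> stair_bound n 0"
      using stair_bound_groth mu(1) unfolding bounded_by_def by blast
    then show ?thesis by (simp add: stair_bound_def)
  qed
  have "groth w * groth r \<in> groth_span"
  proof (rule groth_spanI)
    fix m assume "m \<in> Poly_Mapping.keys (groth w * groth r)"
    then obtain a b where "m = a + b" "a \<in> Poly_Mapping.keys (groth w)" "b \<in> Poly_Mapping.keys (groth r)"
      using keys_mult by blast
    then show "Poly_Mapping.lookup m 0 = 0" using z w by (simp add: lookup_add)
  qed
  then obtain c where c: "Poly_Mapping.keys c \<subseteq> Sym_inf" "groth w * groth r = groth_comb c"
    by (rule groth_span_comb)
  have "(THE c. Poly_Mapping.keys c \<subseteq> Sym_inf \<and> groth w * groth r = groth_comb c) = c"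
  proof (rule the_equality)
    fix d assume d: "Poly_Mapping.keys d \<subseteq> Sym_inf \<and> groth w * groth r = groth_comb d"
    show "d = c"
    proof (rule poly_mapping_eqI)
      fix u
      show "Poly_Mapping.lookup d u = Poly_Mapping.lookup c u"
      proof (cases "u \<in> Sym_inf")
        case True
        then obtain js where "reduced_word u js" using reduced_word_exists Sym_inf_iff by metis
        then show ?thesis using groth_comb_coeff d c by metis
      next
        case False
        then have "u \<notin> Poly_Mapping.keys c" "u \<notin> Poly_Mapping.keys d" using c d by auto
        then show ?thesis by (simp add: in_keys_iff)
      qed
    qed
  qed (use c in auto)
  then show ?thesis
    using groth_comb_coeff[OF v c(1)] c(2) by (simp add: struct_const_def groth_comb_def)
qed

lemma groth_expansion:
  assumes f: "bounded_by (stair_bound n) f"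
    and W: "\<And>u. u \<in> Sym n \<Longrightarrow> reduced_word u (W u)"
  shows "f = (\<Sum>u\<in>Sym n. of_int (const_term (foldr hat (W u) f)) * groth u)"
proof -
  have "f \<in> groth_span"
    using f by (intro groth_spanI) (auto simp: bounded_by_def stair_bound_def dest!: bspec spec[of _ 0])
  then obtain c where c: "Poly_Mapping.keys c \<subseteq> Sym_inf" "f = groth_comb c"
    by (rule groth_span_comb)
  have "Poly_Mapping.keys c \<subseteq> Sym n"
  proof
    fix v assume v: "v \<in> Poly_Mapping.keys c"
    then obtain "is" where r: "reduced_word v is" using c reduced_word_exists Sym_inf_iff by (metis subsetD)
    then have "const_term (foldr hat is f) \<noteq> 0"
      using groth_comb_coeff[OF r c(1)] c(2) v by (simp add: in_keys_iff)
    then have "set is \<subseteq> {1..<n}"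
      using foldr_hat_stair_bound(2)[OF f reduced_wordD(1)[OF r]] substitute.hom_zero by metis
    then show "v \<in> Sym n" using word_perm_Sym reduced_wordD(2)[OF r] by auto
  qed
  moreover have "finite (Sym n)" by (simp add: Sym_def finite_permutations)
  ultimately have "f = (\<Sum>u\<in>Sym n. of_int (Poly_Mapping.lookup c u) * groth u)"
    using c(2) by (simp add: groth_comb_superset)
  also have "\<dots> = (\<Sum>u\<in>Sym n. of_int (const_term (foldr hat (W u) f)) * groth u)"
    using groth_comb_coeff[OF W c(1)] c(2) by (intro sum.cong) auto
  finally show ?thesis .
qed

section \<open>Synthetic division\<close>

lemma synthetic_div_times_linear [simp]:
  fixes P :: "'a::comm_ring_1 poly"
  shows "synthetic_div (P * [:- c, 1:]) c = P"
proof -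
  have "P * [:- c, 1:] + smult c P = pCons 0 P" by (simp add: algebra_simps)
  then show ?thesis using synthetic_div_unique by metis
qed

lemma synthetic_div_diff:
  fixes P Q :: "'a::comm_ring_1 poly"
  shows "synthetic_div (P - Q) c = synthetic_div P c - synthetic_div Q c"
proof -
  have "P - Q + smult c (synthetic_div P c - synthetic_div Q c) =
      (P + smult c (synthetic_div P c)) - (Q + smult c (synthetic_div Q c))"
    by (simp add: smult_diff_right)
  also have "\<dots> = pCons (poly P c - poly Q c) (synthetic_div P c - synthetic_div Q c)"
    by (simp add: synthetic_div_correct)
  finally show ?thesis using synthetic_div_unique by metis
qed

lemma (in comm_ring_hom) hom_synthetic_div:
  "map_poly h (synthetic_div P c) = synthetic_div (map_poly h P) (h c)"
  by (induction P) (simp_all add: map_poly_pCons hom_poly)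

text \<open>
  The coefficients of a quotient by \<open>t - c\<close> are built from those of the dividend by
  additions and multiplications by \<open>c\<close>. This is applied to ideals and to kernels of
  divided differences, which are only modules over a subring.
\<close>

lemma synthetic_div_coeffs:
  assumes zero: "0 \<in> Z" and add: "\<And>a b. a \<in> Z \<Longrightarrow> b \<in> Z \<Longrightarrow> a + b \<in> Z"
    and mult: "\<And>a. a \<in> Z \<Longrightarrow> c * a \<in> Z"
    and P: "\<And>k. coeff P k \<in> Z"
  shows "poly P c \<in> Z \<and> (\<forall>k. coeff (synthetic_div P c) k \<in> Z)"
  using P
proof (induction P)
  case 0
  then show ?case using zero by simp
next
  case (pCons a P)
  have "a \<in> Z" using pCons(3)[of 0] by simp
  moreover have "coeff P k \<in> Z" for k using pCons(3)[of "Suc k"] by simp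
  ultimately show ?case using pCons(2) add mult by (auto simp: coeff_pCons split: nat.splits)
qed

section \<open>The ideal of the flag variety\<close>

locale ring_ideal =
  fixes J :: "'a::comm_ring_1 set"
  assumes zero_mem: "0 \<in> J" and add_mem: "a \<in> J \<Longrightarrow> b \<in> J \<Longrightarrow> a + b \<in> J"
    and mult_mem: "a \<in> J \<Longrightarrow> c * a \<in> J"
begin

lemma mult_mem': "a \<in> J \<Longrightarrow> a * c \<in> J"
  using mult_mem[of a c] by (simp add: mult.commute)

lemma uminus_mem: "a \<in> J \<Longrightarrow> - a \<in> J"
  using mult_mem[of a "- 1"] by simp

lemma sum_mem: "(\<And>x. x \<in> A \<Longrightarrow> f x \<in> J) \<Longrightarrow> sum f A \<in> J"
  by (induction A rule: infinite_finite_induct) (auto intro: zero_mem add_mem)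

definition cong :: "'a \<Rightarrow> 'a \<Rightarrow> bool" (infix "\<approx>" 50) where
  "a \<approx> b \<longleftrightarrow> a - b \<in> J"

definition pcong :: "'a poly \<Rightarrow> 'a poly \<Rightarrow> bool" (infix "\<simeq>" 50) where
  "P \<simeq> Q \<longleftrightarrow> (\<forall>k. coeff P k \<approx> coeff Q k)"

lemma cong_refl: "a \<approx> a"
  by (simp add: cong_def zero_mem)

lemma cong_sym: "a \<approx> b \<Longrightarrow> b \<approx> a"
  unfolding cong_def using uminus_mem[of "a - b"] by simp

lemma cong_trans [trans]: "a \<approx> b \<Longrightarrow> b \<approx> c \<Longrightarrow> a \<approx> c"
  unfolding cong_def using add_mem[of "a - b" "b - c"] by simp

lemma cong_mult: "a \<approx> b \<Longrightarrow> c \<approx> d \<Longrightarrow> a * c \<approx> b * d"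
proof -
  assume "a \<approx> b" "c \<approx> d"
  then have "(a - b) * c + b * (c - d) \<in> J"
    unfolding cong_def by (intro add_mem mult_mem mult_mem')
  then show ?thesis by (simp add: cong_def algebra_simps)
qed

lemma pcong_iff: "P \<simeq> Q \<longleftrightarrow> (\<forall>k. coeff (P - Q) k \<in> J)"
  by (simp add: pcong_def cong_def)

lemma pcong_sym: "P \<simeq> Q \<Longrightarrow> Q \<simeq> P"
  by (auto simp: pcong_def intro: cong_sym)

lemma pcong_trans [trans]: "P \<simeq> Q \<Longrightarrow> Q \<simeq> R \<Longrightarrow> P \<simeq> R"
  unfolding pcong_def by (blast intro: cong_trans)

lemma pcong_mult_left: "P \<simeq> Q \<Longrightarrow> R * P \<simeq> R * Q"
  unfolding pcong_iff
  by (auto simp: right_diff_distrib[symmetric] coeff_mult intro!: sum_mem mult_mem)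

lemma pcong_smult: "P \<simeq> Q \<Longrightarrow> smult c P \<simeq> smult c Q"
  using pcong_mult_left[of P Q "[:c:]"] by simp

lemma pcong_minus: "(\<And>k. coeff S k \<in> J) \<Longrightarrow> P - S \<simeq> P"
  by (simp add: pcong_iff uminus_mem)

lemma pcong_poly: "P \<simeq> Q \<Longrightarrow> poly P x \<approx> poly Q x"
  using synthetic_div_coeffs[of J x "P - Q"]
  by (simp add: pcong_iff cong_def zero_mem add_mem mult_mem)

lemma pcong_synthetic_div: "P \<simeq> Q \<Longrightarrow> synthetic_div P x \<simeq> synthetic_div Q x"
  using synthetic_div_coeffs[of J x "P - Q"]
  unfolding pcong_iff synthetic_div_diff[symmetric] by (auto simp: zero_mem add_mem mult_mem)

text \<open>
  Monic linear factors can be cancelled modulo any ideal, since synthetic division respects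
  congruence.
\<close>

lemma pcong_cancel_linear:
  assumes "[:- c, 1:] * P \<simeq> [:- c, 1:] * Q"
  shows "P \<simeq> Q"
  using pcong_synthetic_div[OF assms, of c] by (simp only: mult.commute[of "[:- c, 1:]"] synthetic_div_times_linear)

lemma synthetic_div_by_ideal:
  assumes "c \<in> J"
  shows "coeff (synthetic_div P c) k \<approx> coeff P (Suc k)"
proof -
  have "coeff (P + smult c (synthetic_div P c)) (Suc k) = coeff (synthetic_div P c) k"
    by (simp only: synthetic_div_correct coeff_pCons_Suc)
  then have "coeff (synthetic_div P c) k - coeff P (Suc k) = coeff (synthetic_div P c) (Suc k) * c"
    by (simp add: algebra_simps)
  then show ?thesis unfolding cong_def using mult_mem[OF assms] by simp
qed

lemma poly_at_ideal: "c \<in> J \<Longrightarrow> poly P c \<approx> coeff P 0"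
  using mult_mem'[of c] by (cases P) (simp add: cong_def)

end

text \<open>
  The largest ideal on which all coordinate functionals belonging to \<open>S\<^sub>N\<close>
  vanish; the quotient is the Grothendieck ring of the variety of flags in
  \<open>N\<close>-space. Being an ideal is immediate from this description, and membership of
  invariants follows from linearity of the operators over invariants.
\<close>

definition flag_ideal :: "nat \<Rightarrow> zpoly set" where
  "flag_ideal N = {F. \<forall>H is. set is \<subseteq> {1..<N} \<longrightarrow> const_term (foldr hat is (F * H)) = 0}"

interpretation flag: ring_ideal "flag_ideal N" for N
proof
  show "0 \<in> flag_ideal N" by (simp add: flag_ideal_def)
  show "a + b \<in> flag_ideal N" if "a \<in> flag_ideal N" "b \<in> flag_ideal N" for a b
    using that by (simp add: flag_ideal_def distrib_right foldr_hat_add)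
  show "c * a \<in> flag_ideal N" if "a \<in> flag_ideal N" for a c
    using that by (simp add: flag_ideal_def mult.assoc mult.left_commute[of c a])
qed

lemma flag_idealD:
  assumes "flag.cong N a b" "set is \<subseteq> {1..<N}"
  shows "const_term (foldr hat is a) = const_term (foldr hat is b)"
proof -
  have "a - b \<in> flag_ideal N" using assms(1) by (simp add: flag.cong_def)
  then have "const_term (foldr hat is ((a - b) * 1)) = 0"
    using assms(2) unfolding flag_ideal_def by blast
  moreover have "foldr hat is a = foldr hat is (a - b) + foldr hat is b"
    by (simp add: foldr_hat_add[symmetric])
  ultimately show ?thesis by simp
qed

lemma flag_ideal_invariant:
  assumes "\<And>i. 1 \<le> i \<Longrightarrow> i < N \<Longrightarrow> s_act i c = c" "const_term c = 0"
  shows "c \<in> flag_ideal N"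
  unfolding flag_ideal_def
proof (intro CollectI allI impI)
  fix H :: zpoly and "is" assume "set is \<subseteq> {1..<N}"
  then have "foldr hat is (c * H) = c * foldr hat is H"
    using assms(1) by (intro foldr_hat_invariant_mult) auto
  then show "const_term (foldr hat is (c * H)) = 0" using assms(2) by simp
qed

lemma flag_ideal_Var: "N < l \<Longrightarrow> Var l \<in> flag_ideal N"
  by (rule flag_ideal_invariant) (auto simp: transpose_def)

lemma map_poly_s_act_hom: "comm_ring_hom (map_poly (s_act i))"
  by (rule s_act.map_poly_hom)

text \<open>
  The coefficients of the difference are symmetric in \<open>x\<^sub>1, \<dots>,
  x\<^sub>N\<close>, and the difference vanishes when all \<open>x\<^sub>i\<close> are set to
  \<open>0\<close>.
\<close>

lemma flag_linear_factors: "flag.pcong N (\<Prod>i=1..N. [:- Var i, 1:]) (monom 1 N)"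
proof -
  define E where "E = (\<Prod>i=1..N. [:- Var i, 1:]) - monom 1 N"
  have "coeff E k \<in> flag_ideal N" for k
  proof (rule flag_ideal_invariant)
    fix i assume i: "1 \<le> i" "i < N"
    interpret m: comm_ring_hom "map_poly (s_act i)" by (rule map_poly_s_act_hom)
    have "map_poly (s_act i) (\<Prod>i=1..N. [:- Var i, 1:]) = (\<Prod>l=1..N. [:- Var (adj i l), 1:])"
      by (simp add: m.hom_prod map_poly_pCons)
    also have "\<dots> = (\<Prod>l=1..N. [:- Var l, 1:])"
      using i by (intro prod.reindex_bij_witness[of _ "adj i" "adj i"]) (auto simp: transpose_def)
    finally have "map_poly (s_act i) E = E"
      by (simp add: E_def map_poly_monom)
    then have "coeff (map_poly (s_act i) E) k = coeff E k" by simp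
    then show "s_act i (coeff E k) = coeff E k" by (simp add: coeff_map_poly)
  next
    interpret m: comm_ring_hom "map_poly const_term" by (rule substitute.map_poly_hom)
    have "map_poly const_term (\<Prod>i=1..N. [:- Var i, 1:]) = monom 1 N"
      by (simp add: m.hom_prod map_poly_pCons monom_altdef)
    then have "map_poly const_term E = 0"
      by (simp add: E_def monom_altdef map_poly_pCons)
    then have "coeff (map_poly const_term E) k = 0" by simp
    then show "const_term (coeff E k) = 0" by (simp add: coeff_map_poly)
  qed
  then show ?thesis by (simp add: flag.pcong_iff E_def)
qed

text \<open>
  For \<open>m = N\<close> this is \<open>\<Prod> (t - x\<^sub>i) = t\<^sup>N\<close> at
  \<open>t = 1\<close>; the further factors are \<open>1\<close> because
  \<open>x\<^sub>l\<close> lies in the ideal for \<open>l > N\<close>.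
\<close>

lemma flag_one_minus_Var:
  assumes "N \<le> m"
  shows "flag.cong N (\<Prod>i=1..m. 1 - Var i) 1"
  using assms
proof (induction m rule: dec_induct)
  case base
  have "poly (\<Prod>i=1..N. [:- Var i, 1:]) 1 = (\<Prod>i=1..N. 1 - Var i)"
    by (simp add: poly_prod)
  then show ?case using flag.pcong_poly[OF flag_linear_factors, of N 1] by (simp add: poly_monom)
next
  case (step m)
  have "flag.cong N (1 - Var (Suc m)) 1"
    unfolding flag.cong_def using flag.uminus_mem[OF flag_ideal_Var[of N "Suc m"]] step by simp
  from flag.cong_mult[OF step.IH this] show ?case by (simp add: mult.commute)
qed

section \<open>The one-row Grothendieck polynomials\<close>

text \<open>
  For \<open>k < N\<close>, \<open>row_poly N k\<close> is the Grothendieck polynomial of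
  \<open>r\<^bsub>[k+1,N-k]\<^esub>\<close> with its last variable
  \<open>x\<^bsub>k+1\<^esub>\<close> replaced by \<open>t\<close>. The recursion is
  \<open>\<pi>\<^bsub>k+1\<^esub>\<close> with \<open>x\<^bsub>k+2\<^esub>\<close> renamed to
  \<open>t\<close>; its denominator \<open>x\<^bsub>k+1\<^esub> - t\<close> turns into a
  synthetic division.
\<close>

fun row_poly :: "nat \<Rightarrow> nat \<Rightarrow> zpoly poly" where
  "row_poly N 0 = monom 1 N"
| "row_poly N (Suc k) = synthetic_div
     (smult (1 - Var (Suc k)) (row_poly N k) - smult (poly (row_poly N k) (Var (Suc k))) [:1, -1:])
     (Var (Suc k))"

lemma row_poly_Suc:
  "[:- Var (Suc k), 1:] * row_poly N (Suc k) =
    smult (1 - Var (Suc k)) (row_poly N k) - smult (poly (row_poly N k) (Var (Suc k))) [:1, -1:]"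
  (is "_ = ?R")
proof -
  have "poly ?R (Var (Suc k)) = 0" by (simp add: algebra_simps)
  then show ?thesis
    using synthetic_div_correct'[of "Var (Suc k)" ?R] by (simp only: row_poly.simps) simp
qed

declare row_poly.simps [simp del]

lemma row_poly_invariant: "k < i \<Longrightarrow> map_poly (s_act i) (row_poly N k) = row_poly N k"
proof (induction k)
  case 0
  then show ?case by (simp add: row_poly.simps map_poly_monom)
next
  case (Suc k)
  interpret m: comm_ring_hom "map_poly (s_act i)" by (rule map_poly_s_act_hom)
  have v: "s_act i (Var (Suc k)) = Var (Suc k)" using Suc by (simp add: transpose_def)
  have p: "s_act i (poly (row_poly N k) (Var (Suc k))) = poly (row_poly N k) (Var (Suc k))"
    using Suc by (simp add: s_act.hom_poly v)
  show ?case using Suc p v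
    by (simp add: row_poly.simps s_act.hom_synthetic_div map_poly_smult map_poly_pCons)
qed

lemma r_perm_Sym_inf: "1 \<le> k \<Longrightarrow> r_perm k p \<in> Sym_inf"
  unfolding r_perm_def by (intro word_perm_Sym_inf) auto

text \<open>
  If the coefficients of \<open>P\<close> are \<open>s\<^sub>i\<close>-invariant,
  \<open>s\<^sub>i\<close> only moves the point of evaluation from \<open>x\<^sub>i\<close> to
  \<open>x\<^bsub>i+1\<^esub>\<close>.
\<close>

lemma demazure_poly_Var:
  assumes "map_poly (s_act i) P = P"
  shows "[:- Var i, 1:] * Q = smult (1 - Var i) P - smult (poly P (Var i)) [:1, -1:] \<Longrightarrow>
    demazure i (poly P (Var i)) = poly Q (Var (Suc i))"
proof (rule demazure_unique)
  assume Q: "[:- Var i, 1:] * Q = smult (1 - Var i) P - smult (poly P (Var i)) [:1, -1:]"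
  have "poly ([:- Var i, 1:] * Q) (Var (Suc i)) =
      (1 - Var i) * poly P (Var (Suc i)) - poly P (Var i) * (1 - Var (Suc i))"
    unfolding Q by (simp add: algebra_simps)
  moreover have "s_act i (poly P (Var i)) = poly P (Var (Suc i))"
    using assms by (simp add: s_act.hom_poly)
  ultimately show "(Var i - Var (Suc i)) * poly Q (Var (Suc i)) =
      (1 - Var (Suc i)) * poly P (Var i) - (1 - Var i) * s_act i (poly P (Var i))"
    by (simp add: algebra_simps)
qed

text \<open>
  Starting from \<open>\<omega>\<^bsub>N+1\<^esub>\<close>, the values behind the leading
  \<open>N + 1\<close> are sorted by moving \<open>N, N - 1, \<dots>\<close> in turn to the
  right; on the polynomial side the exponents of \<open>x\<^sub>2, x\<^sub>3, \<dots>\<close>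
  are lowered until only \<open>x\<^sub>1\<^sup>N\<close> is left.
\<close>

lemma groth_r_perm_1: "groth (r_perm 1 N) = Var 1 ^ N"
proof -
  \<comment> \<open>\<open>v k\<close> is \<open>[N+1, k, k-1, \<dots>, 1, k+1, \<dots>, N]\<close>.\<close>
  define v where "v k x = (if x = 1 then Suc N else if 2 \<le> x \<and> x \<le> Suc k then k + 2 - x
      else if Suc k < x \<and> x \<le> Suc N then x - 1 else x)" for k x :: nat
  have start: "v N = longest (Suc N)"
    by (auto simp: v_def longest_def fun_eq_iff)
  have stop: "v 0 = r_perm 1 N"
    by (auto simp: v_def r_perm_def word_perm_rev_upt fun_eq_iff simp del: upt_Suc)
  have step: "v (Suc k) \<circ> word_perm [2..<Suc (Suc k)] = v k" if "Suc k \<le> N" for k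
  proof
    fix x
    have "word_perm [2..<Suc (Suc k)] x =
        (if x = Suc (Suc k) then 2 else if 2 \<le> x \<and> x < Suc (Suc k) then Suc x else x)"
      by (rule word_perm_upt) simp
    moreover consider "x < 2" | "2 \<le> x" "x < Suc (Suc k)" | "x = Suc (Suc k)" | "Suc (Suc k) < x"
      by linarith
    then show "(v (Suc k) \<circ> word_perm [2..<Suc (Suc k)]) x = v k x"
      unfolding comp_apply calculation by cases (use that in \<open>simp_all add: v_def\<close>)
  qed
  have main: "v (N - d) \<in> Sym_inf \<and>
      groth (v (N - d)) = (\<Prod>i=1..Suc N. Var i ^ (if i = 1 then N else N - d + 1 - i))"
    if "d \<le> N" for d
    using that
  proof (induction d)
    case 0
    have "(\<Prod>i=1..Suc N. Var i ^ (if i = 1 then N else N - 0 + 1 - i)) = staircase (Suc N)"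
      by (intro prod.cong) auto
    then show ?case using start groth_longest[of "Suc N"] longest_Sym Sym_inf_iff by auto
  next
    case (Suc d)
    define k where "k = N - Suc d"
    have k: "N - d = Suc k" "Suc k \<le> N" using Suc(2) by (auto simp: k_def)
    have IH: "v (Suc k) \<in> Sym_inf"
      "groth (v (Suc k)) = (\<Prod>i=1..Suc N. Var i ^ (if i = 1 then N else Suc k + 1 - i))"
      using Suc.IH[unfolded k(1)] Suc(2) by auto
    have vk: "v k \<in> Sym_inf"
      unfolding step[OF k(2), symmetric] by (intro Sym_inf_comp IH word_perm_Sym_inf) auto
    have "groth (v k) = foldr demazure (rev [2..<Suc (Suc k)]) (groth (v (Suc k)))"
      unfolding step[OF k(2), symmetric] using IH(1) k(2)
      by (intro demazure_cycle_groth[symmetric]) (auto simp: v_def)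
    also have "\<dots> = (\<Prod>i=1..Suc N. Var i ^ (if 2 \<le> i \<and> i < Suc (Suc k)
        then (if i = 1 then N else Suc k + 1 - i) - 1 else (if i = 1 then N else Suc k + 1 - i)))"
      unfolding IH(2) using k(2) by (intro demazure_cycle_powers) auto
    also have "\<dots> = (\<Prod>i=1..Suc N. Var i ^ (if i = 1 then N else k + 1 - i))"
      by (intro prod.cong arg_cong2[where f = "(^)"]) auto
    finally show ?case using vk unfolding k_def by blast
  qed
  have "groth (r_perm 1 N) = (\<Prod>i=1..Suc N. Var i ^ (if i = 1 then N else 1 - i))"
    using main[of N] unfolding diff_self_eq_0 add_0 stop by blast
  also have "\<dots> = (\<Prod>i=1..Suc N. if i = 1 then Var 1 ^ N else 1)"
    by (intro prod.cong) auto
  also have "\<dots> = Var 1 ^ N" by (subst prod.delta) auto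
  finally show ?thesis .
qed

lemma groth_r_perm:
  assumes "k < N"
  shows "groth (r_perm (Suc k) (N - k)) = poly (row_poly N k) (Var (Suc k))"
  using assms
proof (induction k)
  case 0
  then show ?case using groth_r_perm_1[of N] by (simp add: row_poly.simps poly_monom)
next
  case (Suc k)
  have r: "r_perm (Suc k) (N - k) = word_perm (rev [Suc k..<Suc N])"
    "r_perm (Suc (Suc k)) (N - Suc k) = word_perm (rev [Suc (Suc k)..<Suc N])"
    using Suc by (auto simp: r_perm_def)
  have "rev [Suc k..<Suc N] = rev [Suc (Suc k)..<Suc N] @ [Suc k]"
    using Suc by (subst upt_conv_Cons) auto
  then have "word_perm (rev [Suc k..<Suc N]) = word_perm (rev [Suc (Suc k)..<Suc N]) \<circ> adj (Suc k)"
    by (simp only: word_perm_append word_perm_Cons word_perm_Nil comp_id)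
  then have "word_perm (rev [Suc (Suc k)..<Suc N]) = r_perm (Suc k) (N - k) \<circ> adj (Suc k)"
    by (simp only: r comp_adj_adj)
  then have "groth (r_perm (Suc (Suc k)) (N - Suc k)) = groth (r_perm (Suc k) (N - k) \<circ> adj (Suc k))"
    by (simp only: r)
  also have "\<dots> = demazure (Suc k) (groth (r_perm (Suc k) (N - k)))"
  proof (rule demazure_groth_descent[symmetric])
    show "r_perm (Suc k) (N - k) (Suc (Suc k)) < r_perm (Suc k) (N - k) (Suc k)"
      unfolding r using Suc(2) by (simp add: word_perm_rev_upt del: upt_Suc)
  qed (auto intro: r_perm_Sym_inf)
  also have "\<dots> = demazure (Suc k) (poly (row_poly N k) (Var (Suc k)))" using Suc by simp
  also have "\<dots> = poly (row_poly N (Suc k)) (Var (Suc (Suc k)))"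
    by (rule demazure_poly_Var[OF row_poly_invariant row_poly_Suc]) simp
  finally show ?case .
qed

text \<open>
  By induction the polynomial vanishes at \<open>t = x\<^bsub>k+1\<^esub>\<close> modulo the
  ideal, so the second term of the recursion disappears and the factor \<open>t -
  x\<^bsub>k+1\<^esub>\<close> cancels.
\<close>

lemma row_poly_flag:
  assumes "k \<le> N"
  shows "flag.pcong N (row_poly N k)
    (smult (\<Prod>i=1..k. 1 - Var i) (\<Prod>i=Suc k..N. [:- Var i, 1:]))"
  using assms
proof (induction k)
  case 0
  then show ?case using flag.pcong_sym[OF flag_linear_factors] by (simp add: row_poly.simps)
next
  case (Suc k)
  let ?x = "Var (Suc k)" and ?C = "\<Prod>i=1..k. 1 - Var i"
  let ?L = "\<Prod>i=Suc (Suc k)..N. [:- Var i, 1:]"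
  \<comment> \<open>The factor \<open>t - x\<^bsub>k+1\<^esub>\<close> is made explicit, to be evaluated at its zero and then cancelled.\<close>
  have split: "(\<Prod>i=Suc k..N. [:- Var i, 1:]) = [:- ?x, 1:] * ?L"
    using Suc(2) by (simp add: prod.atLeast_Suc_atMost)
  have IH: "flag.pcong N (row_poly N k) (smult ?C ([:- ?x, 1:] * ?L))"
    using Suc split by simp
  from flag.pcong_poly[OF IH, of ?x] have "poly (row_poly N k) ?x \<in> flag_ideal N"
    by (simp add: flag.cong_def)
  then have r: "coeff (smult (poly (row_poly N k) ?x) [:1, -1:]) j \<in> flag_ideal N" for j
    by (simp only: coeff_smult flag.mult_mem')
  have "flag.pcong N ([:- ?x, 1:] * row_poly N (Suc k)) (smult (1 - ?x) (row_poly N k))"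
    unfolding row_poly_Suc using r by (rule flag.pcong_minus)
  also note flag.pcong_smult[OF IH, of "1 - ?x"]
  finally
  have "flag.pcong N ([:- ?x, 1:] * row_poly N (Suc k)) (smult (1 - ?x) (smult ?C ([:- ?x, 1:] * ?L)))" .
  also have "smult (1 - ?x) (smult ?C ([:- ?x, 1:] * ?L)) = [:- ?x, 1:] * smult (\<Prod>i=1..Suc k. 1 - Var i) ?L"
    by (simp only: mult_smult_right smult_smult) (simp add: mult.commute)
  finally show ?case by (rule flag.pcong_cancel_linear)
qed

section \<open>Iterated divided differences of an inserted variable\<close>

definition ddiff_chain :: "nat \<Rightarrow> nat \<Rightarrow> zpoly \<Rightarrow> zpoly" where
  "ddiff_chain a b = foldr ddiff (rev [a..<b])"

lemma ddiff_chain_refl [simp]: "ddiff_chain a a f = f"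
  by (simp add: ddiff_chain_def)

lemma ddiff_chain_Suc: "a < b \<Longrightarrow> ddiff_chain a b f = ddiff_chain (Suc a) b (ddiff a f)"
  by (simp add: ddiff_chain_def upt_conv_Cons)

lemma ddiff_chain_Suc_right: "a \<le> b \<Longrightarrow> ddiff_chain a (Suc b) f = ddiff b (ddiff_chain a b f)"
  by (simp add: ddiff_chain_def)

lemma foldr_ddiff_zero [simp]: "foldr ddiff is 0 = 0"
  by (induction "is") auto

lemma foldr_ddiff_add: "foldr ddiff is (f + g) = foldr ddiff is f + foldr ddiff is g"
  by (induction "is") (auto simp: ddiff_add)

lemma foldr_ddiff_invariant_mult:
  "(\<And>i. i \<in> set is \<Longrightarrow> s_act i c = c) \<Longrightarrow> foldr ddiff is (c * f) = c * foldr ddiff is f"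
  by (induction "is") (auto simp: ddiff_invariant_mult)

lemma ddiff_chain_zero [simp]: "ddiff_chain a b 0 = 0"
  by (simp add: ddiff_chain_def)

lemma ddiff_chain_add: "ddiff_chain a b (f + g) = ddiff_chain a b f + ddiff_chain a b g"
  by (simp add: ddiff_chain_def foldr_ddiff_add)

lemma ddiff_chain_invariant_mult:
  "(\<And>i. a \<le> i \<Longrightarrow> s_act i c = c) \<Longrightarrow> ddiff_chain a b (c * f) = c * ddiff_chain a b f"
  unfolding ddiff_chain_def by (rule foldr_ddiff_invariant_mult) simp

lemma hat_chain:
  assumes "q \<le> m"
  shows "foldr hat (rev [q..<m]) f = (\<Prod>i=q..<m. 1 - Var i) * ddiff_chain q m f"
  using assms
proof (induction m rule: dec_induct)
  case (step m)
  have c: "s_act m (\<Prod>i=q..<m. 1 - Var i) = (\<Prod>i=q..<m. 1 - Var i)"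
    unfolding s_act.hom_prod by (intro prod.cong) (auto simp: transpose_def)
  have "foldr hat (rev [q..<Suc m]) f = hat m ((\<Prod>i=q..<m. 1 - Var i) * ddiff_chain q m f)"
    using step by simp
  also have "\<dots> = (\<Prod>i=q..<m. 1 - Var i) * ((1 - Var m) * ddiff m (ddiff_chain q m f))"
    unfolding hat_invariant_mult[OF c] by (simp only: hat_def)
  also have "\<dots> = (\<Prod>i=q..<Suc m. 1 - Var i) * ddiff_chain q (Suc m) f"
    using step(1) by (simp only: ddiff_chain_Suc_right prod.atLeastLessThan_Suc mult.assoc)
  finally show ?case .
qed simp

text \<open>
  Each divided difference strictly lowers the larger of the two exponents involved. The bound
  \<open>n - l\<close> on the exponent of \<open>x\<^sub>l\<close> decreases in step, and
  reaches \<open>0\<close> before the chain ends.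
\<close>

lemma ddiff_chain_vanishes:
  assumes "i < m" "n \<le> m" "bounded_by b h" "b i \<le> n - Suc i" "\<And>l. i < l \<Longrightarrow> b l \<le> n - l"
  shows "ddiff_chain i m h = 0"
  using assms(1,3-)
proof (induction i arbitrary: b h rule: strict_inc_induct)
  case (base i)
  then have "b i = 0" "b (Suc i) = 0" using assms(2) base(3) base(4)[of "Suc i"] by auto
  then show ?case using base(1) bounded_by_ddiff_eq_0[OF base(2), of i]
    by (simp add: ddiff_chain_Suc)
next
  case (step i)
  define M where "M = max (b i) (b (Suc i))"
  let ?b = "b(i := M - 1, Suc i := M - 1)"
  have "ddiff_chain (Suc i) m (ddiff i h) = 0"
  proof (rule step.IH)
    show "bounded_by ?b (ddiff i h)" unfolding M_def by (rule bounded_by_ddiff[OF step(3)])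
    have "M \<le> n - Suc i" using step(4) step(5)[of "Suc i"] by (simp add: M_def)
    then show "?b (Suc i) \<le> n - Suc (Suc i)" by simp
    show "?b l \<le> n - l" if "Suc i < l" for l using that step(5)[of l] by simp
  qed
  then show ?case using step(1) by (simp add: ddiff_chain_Suc)
qed

text \<open>
  The Leibniz rule for a polynomial evaluated at \<open>x\<^sub>i\<close>: either
  \<open>\<partial>\<^sub>i\<close> hits the coefficients, or it hits the powers of
  \<open>x\<^sub>i\<close>, which amounts to synthetic division.
\<close>

lemma ddiff_poly:
  "ddiff i (poly P (Var i)) =
    poly (map_poly (ddiff i) P) (Var i) +
    poly (synthetic_div (map_poly (s_act i) P) (Var i)) (Var (Suc i))"
proof (rule ddiff_unique)
  let ?x = "Var i" and ?y = "Var (Suc i)" and ?P = "map_poly (s_act i) P"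
  have 1: "(?x - ?y) * poly (map_poly (ddiff i) P) z = poly P z - poly ?P z" for z
  proof (induction P)
    case (pCons a P)
    have "(?x - ?y) * poly (map_poly (ddiff i) (pCons a P)) z =
        (?x - ?y) * ddiff i a + z * ((?x - ?y) * poly (map_poly (ddiff i) P) z)"
      by (simp add: map_poly_pCons algebra_simps)
    also have "\<dots> = poly (pCons a P) z - poly (map_poly (s_act i) (pCons a P)) z"
      unfolding pCons ddiff by (simp add: map_poly_pCons algebra_simps)
    finally show ?case .
  qed simp
  have "poly ([:- ?x, 1:] * synthetic_div ?P ?x + [:poly ?P ?x:]) ?y = poly ?P ?y"
    by (simp only: synthetic_div_correct')
  then have 2: "(?x - ?y) * poly (synthetic_div ?P ?x) ?y = poly ?P ?x - poly ?P ?y"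
    by (simp add: algebra_simps)
  have "s_act i (poly P ?x) = poly ?P ?y" by (simp add: s_act.hom_poly)
  then show "(?x - ?y) * (poly (map_poly (ddiff i) P) ?x + poly (synthetic_div ?P ?x) ?y) =
      poly P ?x - s_act i (poly P ?x)"
    unfolding distrib_left 1 2 by simp
qed

lemma ddiff_chain_poly:
  assumes "a < b" "\<And>k. ddiff_chain a b (coeff P k) = 0"
  shows "ddiff_chain (Suc a) b (poly (map_poly (ddiff a) P) (Var a)) = 0"
  using assms(2)
proof (induction P)
  case (pCons c P)
  have v: "s_act i (Var a) = Var a" if "Suc a \<le> i" for i
    using that by (simp add: transpose_def)
  have "ddiff_chain (Suc a) b (ddiff a c) = 0"
    using pCons(3)[of 0] assms(1) by (simp add: ddiff_chain_Suc)
  moreover have "ddiff_chain a b (coeff P k) = 0" for k using pCons(3)[of "Suc k"] by simp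
  then have "ddiff_chain (Suc a) b (poly (map_poly (ddiff a) P) (Var a)) = 0" by (rule pCons.IH)
  ultimately show ?case
    by (simp add: map_poly_pCons ddiff_chain_add ddiff_chain_invariant_mult[OF v])
qed simp

text \<open>
  The quotient by \<open>\<Prod>\<^bsub>a\<le>i<b\<^esub> (t - x\<^sub>i)\<close>, one linear
  factor at a time.
\<close>

definition div_chain :: "nat \<Rightarrow> nat \<Rightarrow> zpoly poly \<Rightarrow> zpoly poly" where
  "div_chain a b = foldr (\<lambda>i P. synthetic_div P (Var i)) (rev [a..<b])"

lemma div_chain_refl [simp]: "div_chain a a P = P"
  by (simp add: div_chain_def)

lemma div_chain_Suc: "a \<le> b \<Longrightarrow> div_chain a (Suc b) P = synthetic_div (div_chain a b P) (Var b)"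
  by (simp add: div_chain_def)

lemma div_chain_split: "b \<le> c \<Longrightarrow> a \<le> b \<Longrightarrow> div_chain a c P = div_chain b c (div_chain a b P)"
  by (induction c rule: dec_induct) (auto simp: div_chain_Suc)

lemma div_chain_coeffs:
  assumes "a \<le> b" "0 \<in> Z" "\<And>x y. x \<in> Z \<Longrightarrow> y \<in> Z \<Longrightarrow> x + y \<in> Z"
    and "\<And>i x. i < b \<Longrightarrow> x \<in> Z \<Longrightarrow> Var i * x \<in> Z" "\<And>k. coeff P k \<in> Z"
  shows "coeff (div_chain a b P) k \<in> Z"
  using assms(1,4)
proof (induction b arbitrary: k rule: dec_induct)
  case base
  then show ?case using assms(5) by simp
next
  case (step b)
  then show ?case
    using synthetic_div_coeffs[of Z "Var b" "div_chain a b P"] assms(2,3) by (simp add: div_chain_Suc)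
qed

lemma div_chain_s_act:
  assumes "a \<le> b" "b \<le> i"
  shows "map_poly (s_act i) (div_chain a b P) = div_chain a b (map_poly (s_act i) P)"
  using assms
proof (induction b rule: dec_induct)
  case (step b)
  then show ?case by (simp add: div_chain_Suc s_act.hom_synthetic_div transpose_def)
qed simp

lemma div_chain_linear_factors:
  "a \<le> b \<Longrightarrow> div_chain a b (P * (\<Prod>i=a..<b. [:- Var i, 1:])) = P"
proof (induction b arbitrary: P rule: dec_induct)
  case (step b)
  have "P * (\<Prod>i=a..<Suc b. [:- Var i, 1:]) = P * [:- Var b, 1:] * (\<Prod>i=a..<b. [:- Var i, 1:])"
    using step(1) by (simp only: prod.atLeastLessThan_Suc mult_ac)
  then show ?case using step by (simp only: div_chain_Suc step.IH synthetic_div_times_linear)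
qed simp

lemma div_chain_pcong:
  "flag.pcong N P Q \<Longrightarrow> a \<le> b \<Longrightarrow> flag.pcong N (div_chain a b P) (div_chain a b Q)"
proof (induction b)
  case (Suc b)
  then show ?case
    by (cases "a = Suc b") (auto simp: div_chain_Suc intro: flag.pcong_synthetic_div)
qed simp

lemma div_chain_ideal:
  "flag.cong N (coeff (div_chain (Suc N) (Suc N + j) P) k) (coeff P (k + j))"
proof (induction j arbitrary: k)
  case (Suc j)
  have "flag.cong N (coeff (div_chain (Suc N) (Suc N + Suc j) P) k) (coeff (div_chain (Suc N) (Suc N + j) P) (Suc k))"
    using flag.synthetic_div_by_ideal[OF flag_ideal_Var[of N "Suc N + j"]]
    by (simp add: div_chain_Suc)
  also note Suc[of "Suc k"]
  finally show ?case by simp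
qed (simp add: flag.cong_refl)

definition shift_subst :: "nat \<Rightarrow> (nat \<Rightarrow> nat) \<Rightarrow> zpoly \<Rightarrow> zpoly poly" where
  "shift_subst q \<sigma> = substitute (\<lambda>l. if l = q then Y else [:Var (\<sigma> l):])"

text \<open>
  A monomial is sent to a power of the new variable times a monomial whose exponents are moved
  along \<open>\<sigma>\<close>; injectivity of \<open>\<sigma>\<close> away from
  \<open>q\<close> prevents exponents from being added up.
\<close>

lemma bounded_by_shift_subst:
  assumes f: "bounded_by b f" and inj: "inj_on \<sigma> (- {q})" and b: "\<And>l. l \<noteq> q \<Longrightarrow> b l \<le> b' (\<sigma> l)"
  shows "bounded_by b' (coeff (shift_subst q \<sigma> f) k)"
proof -
  define \<tau> where "\<tau> m = (\<Sum>l\<in>Poly_Mapping.keys m - {q}. Poly_Mapping.single (\<sigma> l) (Poly_Mapping.lookup m l))"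
    for m :: "nat \<Rightarrow>\<^sub>0 nat"
  have val: "monomial_value (\<lambda>l. if l = q then Y else [:Var (\<sigma> l):]) m =
      monom (monomial (\<tau> m)) (Poly_Mapping.lookup m q)" for m
  proof -
    let ?g = "\<lambda>l. if l = q then Y else [:Var (\<sigma> l):]"
    have "monomial_value ?g m = (\<Prod>l\<in>insert q (Poly_Mapping.keys m). ?g l ^ Poly_Mapping.lookup m l)"
      by (rule monomial_value_superset) auto
    also have "\<dots> = Y ^ Poly_Mapping.lookup m q *
        (\<Prod>l\<in>Poly_Mapping.keys m - {q}. ?g l ^ Poly_Mapping.lookup m l)"
      by (subst prod.insert_remove) auto
    also have "(\<Prod>l\<in>Poly_Mapping.keys m - {q}. ?g l ^ Poly_Mapping.lookup m l) =
        (\<Prod>l\<in>Poly_Mapping.keys m - {q}. [:Var (\<sigma> l) ^ Poly_Mapping.lookup m l:])"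
      by (intro prod.cong) (auto simp: poly_const_pow)
    also have "\<dots> = [:monomial (\<tau> m):]"
      unfolding \<tau>_def prod_Var_powers[symmetric]
      by (rule comm_ring_hom.hom_prod[OF comm_ring_hom_const_poly, symmetric])
    finally show ?thesis by (simp add: Y_def monom_altdef mult.commute)
  qed
  have \<tau>: "Poly_Mapping.lookup (\<tau> m) l' \<le> b' l'" if "m \<in> Poly_Mapping.keys f" for m l'
  proof (cases "\<exists>l. l \<noteq> q \<and> \<sigma> l = l'")
    case True
    then obtain l where l: "l \<noteq> q" "\<sigma> l = l'" by blast
    have "Poly_Mapping.lookup (\<tau> m) l' =
        (\<Sum>k\<in>Poly_Mapping.keys m - {q}. if k = l then Poly_Mapping.lookup m l else 0)"
      unfolding \<tau>_def lookup_sum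
      by (intro sum.cong) (use l inj in \<open>auto simp: lookup_single when_def inj_on_def\<close>)
    also have "\<dots> \<le> Poly_Mapping.lookup m l" by simp
    also have "\<dots> \<le> b l" using f that by (auto simp: bounded_by_def)
    also have "\<dots> \<le> b' l'" using b[OF l(1)] l(2) by simp
    finally show ?thesis .
  next
    case False
    then have "Poly_Mapping.lookup (\<tau> m) l' = 0"
      unfolding \<tau>_def lookup_sum by (intro sum.neutral) (auto simp: lookup_single when_def)
    then show ?thesis by simp
  qed
  have "bounded_by b' (of_int c * monomial (\<tau> m))" if "m \<in> Poly_Mapping.keys f" for c m
    using \<tau>[OF that] unfolding bounded_by_def of_int_zpoly mult_single by auto
  moreover have z: "bounded_by b' 0" by (simp add: bounded_by_def)
  moreover have "coeff (of_int c * monom p j) k = (if j = k then of_int c * p else 0)" for c and p :: zpoly and j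
    by (simp add: of_int_poly coeff_monom_mult)
  ultimately have "bounded_by b' (coeff (of_int (Poly_Mapping.lookup f m) * monom (monomial (\<tau> m)) (Poly_Mapping.lookup m q)) k)"
    if "m \<in> Poly_Mapping.keys f" for m using that by auto
  then have "bounded_by b' (\<Sum>m\<in>A. coeff (of_int (Poly_Mapping.lookup f m) * monom (monomial (\<tau> m)) (Poly_Mapping.lookup m q)) k)"
    if "A \<subseteq> Poly_Mapping.keys f" for A
    using that by (induction A rule: infinite_finite_induct) (auto simp: z intro: bounded_by_add)
  then show ?thesis
    unfolding shift_subst_def substitute_def monomial_value_def[symmetric] val coeff_sum by simp
qed

text \<open>
  The insertion of a new variable at position \<open>q\<close>, carried out only up to
  \<open>x\<^sub>i\<close>: from \<open>i\<close> to \<open>i + 1\<close> it changes by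
  \<open>s\<^sub>i\<close>, and \<open>x\<^sub>i\<close> itself does not occur in its
  coefficients.
\<close>

definition partial_insert :: "nat \<Rightarrow> nat \<Rightarrow> zpoly \<Rightarrow> zpoly poly" where
  "partial_insert q i = shift_subst q (\<lambda>l. if q < l \<and> l \<le> i then l - 1 else l)"

lemma partial_insert_hom: "comm_ring_hom (partial_insert q i)"
  unfolding partial_insert_def shift_subst_def by (rule substitute.comm_ring_hom_axioms)

lemma partial_insert_Var:
  "partial_insert q i (Var l) =
    (if l = q then Y else [:Var (if q < l \<and> l \<le> i then l - 1 else l):])"
  by (simp add: partial_insert_def shift_subst_def)

lemma poly_partial_insert: "poly (partial_insert q q f) (Var q) = f"
proof -
  have "comm_ring_hom (\<lambda>p. poly p (Var q))" by unfold_locales auto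
  from hom_eqI[OF comm_ring_hom_comp[OF this partial_insert_hom] comm_ring_hom_id]
  show ?thesis by (auto simp: partial_insert_Var Y_def)
qed

lemma partial_insert_step:
  assumes "q \<le> i"
  shows "map_poly (s_act i) (partial_insert q i f) = partial_insert q (Suc i) f"
proof (rule hom_eqI[OF comm_ring_hom_comp[OF map_poly_s_act_hom partial_insert_hom] partial_insert_hom])
  show "map_poly (s_act i) (partial_insert q i (Var l)) = partial_insert q (Suc i) (Var l)" for l
    using assms by (auto simp: partial_insert_Var Y_def map_poly_pCons transpose_def)
qed

lemma ddiff_chain_partial_insert:
  assumes f: "bounded_by (stair_bound n) f" and "q \<le> i" "i < m" "n \<le> m"
  shows "ddiff_chain i m (coeff (partial_insert q i f) k) = 0"
proof (rule ddiff_chain_vanishes)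
  let ?b = "\<lambda>l. if l < i then n else if l = i then 0 else n - l"
  show "bounded_by ?b (coeff (partial_insert q i f) k)"
    unfolding partial_insert_def using assms(2)
    by (intro bounded_by_shift_subst[OF f]) (auto simp: inj_on_def stair_bound_def)
qed (use assms in auto)

text \<open>
  The divided difference \<open>\<partial>\<^sub>i\<close> is applied to
  \<open>P\<^sub>i(x\<^sub>i)\<close>, where \<open>P\<^sub>i\<close> is the quotient reached so
  far. By \<open>ddiff_poly\<close> it produces
  \<open>P\<^bsub>i+1\<^esub>(x\<^bsub>i+1\<^esub>)\<close> and a cross term in which
  \<open>\<partial>\<^sub>i\<close> acts on the coefficients of \<open>P\<^sub>i\<close>. The
  rest of the chain acts on those coefficients as well and kills them, because the exponents of
  \<open>f\<close> satisfy the staircase bound.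
\<close>

lemma ddiff_chain_insert:
  assumes f: "bounded_by (stair_bound n) f" and q: "q \<le> m" "n \<le> m"
    and G: "\<And>i. q \<le> i \<Longrightarrow> map_poly (s_act i) G = G"
  shows "ddiff_chain q m (f * poly G (Var q)) =
    poly (div_chain q m (partial_insert q m f * G)) (Var m)"
proof -
  define P where "P i = div_chain q i (partial_insert q i f * G)" for i
  have "ddiff_chain q m (f * poly G (Var q)) = ddiff_chain i m (poly (P i) (Var i))"
    if "q \<le> i" "i \<le> m" for i
    using that
  proof (induction i rule: dec_induct)
    case base
    then show ?case by (simp add: P_def poly_partial_insert)
  next
    case (step i)
    interpret m: comm_ring_hom "map_poly (s_act i)" by (rule map_poly_s_act_hom)
    \<comment> \<open>\<open>Z\<close> is a module over the polynomials in \<open>x\<^sub>1, \<dots>, x\<^bsub>i-1\<^esub>\<close>, which suffices for the divisions done so far.\<close>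
    define Z where "Z = {c. ddiff_chain i m c = 0}"
    have Z: "0 \<in> Z" "\<And>x y. x \<in> Z \<Longrightarrow> y \<in> Z \<Longrightarrow> x + y \<in> Z"
      "\<And>l x. l < i \<Longrightarrow> x \<in> Z \<Longrightarrow> Var l * x \<in> Z"
      by (auto simp: Z_def ddiff_chain_add ddiff_chain_invariant_mult transpose_def)
    have Gi: "s_act l (coeff G k) = coeff G k" if "i \<le> l" for l k
    proof -
      have "coeff (map_poly (s_act l) G) k = coeff G k" using G[of l] that step by simp
      then show ?thesis by (simp add: coeff_map_poly)
    qed
    have "coeff (partial_insert q i f) a * coeff G b \<in> Z" for a b
      using ddiff_chain_partial_insert[OF f step(1), of m a] step q
      by (simp add: Z_def mult.commute[of _ "coeff G b"] ddiff_chain_invariant_mult[OF Gi])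
    moreover have "sum g A \<in> Z" if "\<And>x. x \<in> A \<Longrightarrow> g x \<in> Z" for g and A :: "nat set"
      using that by (induction A rule: infinite_finite_induct) (auto simp: Z)
    ultimately have "coeff (partial_insert q i f * G) k \<in> Z" for k
      by (simp add: coeff_mult)
    then have "coeff (P i) k \<in> Z" for k
      unfolding P_def using step Z by (intro div_chain_coeffs) auto
    then have cross: "ddiff_chain (Suc i) m (poly (map_poly (ddiff i) (P i)) (Var i)) = 0"
      using step by (intro ddiff_chain_poly) (auto simp: Z_def)
    have "map_poly (s_act i) (P i) = div_chain q i (partial_insert q (Suc i) f * G)"
      unfolding P_def using step by (simp add: div_chain_s_act partial_insert_step G)
    then have "synthetic_div (map_poly (s_act i) (P i)) (Var i) = P (Suc i)"
      using step by (simp add: P_def div_chain_Suc)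
    then have "ddiff_chain i m (poly (P i) (Var i)) = ddiff_chain (Suc i) m (poly (P (Suc i)) (Var (Suc i)))"
      using step cross by (simp add: ddiff_chain_Suc ddiff_poly ddiff_chain_add)
    then show ?case using step by simp
  qed
  from this[of m] show ?thesis using q by (simp add: P_def)
qed

lemma insert_var_eq:
  assumes f: "bounded_by (stair_bound n) f" and "n \<le> Suc m" "1 \<le> q"
  shows "partial_insert q m f = insert_var q f"
  unfolding partial_insert_def shift_subst_def insert_var_def
proof (rule substitute_cong)
  fix mm i assume "mm \<in> Poly_Mapping.keys f" "i \<in> Poly_Mapping.keys mm"
  then have "stair_bound n i \<noteq> 0"
    using f unfolding bounded_by_def by (metis in_keys_iff le_zero_eq)
  then have "i \<le> m" using assms(2) by (auto simp: stair_bound_def split: if_splits)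
  then show "(if i = q then Y else [:Var (if q < i \<and> i \<le> m then i - 1 else i):]) =
      (if i < q then [:Var i:] else if i = q then Y else [:Var (i - 1):])" by auto
qed

section \<open>Structure constants and coefficients of the inserted variable\<close>

text \<open>
  In the Grothendieck ring of the flag variety, inserting \<open>t\<close> and multiplying by
  the one-row polynomial becomes multiplication by linear factors \<open>t - x\<^sub>i\<close>,
  and these are exactly the factors by which the divided differences divide.
\<close>

lemma const_term_hat_insert:
  assumes f: "bounded_by (stair_bound n) f" and N: "n \<le> Suc N" "1 \<le> q" "q \<le> N"
    and word: "set is \<subseteq> {1..<N}"
  shows "const_term (foldr hat (is @ rev [q..<N + j + 1]) (f * groth (r_perm q (N - q + 1)))) =
    const_term (foldr hat is (coeff (insert_var q f) j))"
proof -
  define m where "m = N + j + 1"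
  define D where "D = row_poly N (q - 1)"
  define F where "F = insert_var q f"
  define C where "C = (\<Prod>i=1..q - 1. 1 - Var i)"
  define B where "B = (\<Prod>i=q..<m. 1 - Var i)"
  have m: "q \<le> m" "n \<le> m" "m = Suc N + j" using N by (auto simp: m_def)
  have "Suc (q - 1) = q" "N - (q - 1) = N - q + 1" "q - 1 < N" using N by auto
  then have "groth (r_perm q (N - q + 1)) = poly D (Var q)"
    using groth_r_perm[of "q - 1" N] by (simp only: D_def)
  then have "foldr hat (rev [q..<m]) (f * groth (r_perm q (N - q + 1))) =
      B * ddiff_chain q m (f * poly D (Var q))"
    unfolding B_def using hat_chain[OF m(1)] by simp
  also have "ddiff_chain q m (f * poly D (Var q)) = poly (div_chain q m (F * D)) (Var m)"
    using ddiff_chain_insert[OF f m(1,2), of D] insert_var_eq[OF f, of m q] N m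
    by (simp add: F_def D_def row_poly_invariant)
  finally have eq: "foldr hat (rev [q..<m]) (f * groth (r_perm q (N - q + 1))) =
      B * poly (div_chain q m (F * D)) (Var m)" .
  have "flag.pcong N D (smult C (\<Prod>i=q..N. [:- Var i, 1:]))"
    using row_poly_flag[of "q - 1" N] N by (simp add: D_def C_def)
  then have "flag.pcong N (F * D) (F * smult C (\<Prod>i=q..N. [:- Var i, 1:]))"
    by (rule flag.pcong_mult_left)
  then have "flag.pcong N (div_chain q (Suc N) (F * D))
      (div_chain q (Suc N) (F * smult C (\<Prod>i=q..N. [:- Var i, 1:])))"
    using N by (intro div_chain_pcong) auto
  also have "F * smult C (\<Prod>i=q..N. [:- Var i, 1:]) = smult C F * (\<Prod>i=q..<Suc N. [:- Var i, 1:])"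
    by (simp add: atLeastLessThanSuc_atLeastAtMost)
  also have "div_chain q (Suc N) \<dots> = smult C F"
    using N by (intro div_chain_linear_factors) auto
  finally have Q: "flag.pcong N (div_chain q (Suc N) (F * D)) (smult C F)" .
  have "flag.cong N (poly (div_chain q m (F * D)) (Var m)) (coeff (div_chain q m (F * D)) 0)"
    using m by (intro flag.poly_at_ideal flag_ideal_Var) auto
  also have "flag.cong N \<dots> (coeff (div_chain q (Suc N) (F * D)) j)"
    using div_chain_ideal[of N j "div_chain q (Suc N) (F * D)" 0] div_chain_split[of "Suc N" m q "F * D"] m N
    by simp
  also have "flag.cong N \<dots> (C * coeff F j)"
    using Q unfolding flag.pcong_def by simp
  finally
  have "flag.cong N (poly (div_chain q m (F * D)) (Var m)) (C * coeff F j)" .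
  then have "flag.cong N (B * poly (div_chain q m (F * D)) (Var m)) (B * (C * coeff F j))"
    by (intro flag.cong_mult flag.cong_refl)
  also have "B * (C * coeff F j) = (\<Prod>i=1..N + j. 1 - Var i) * coeff F j"
  proof -
    have "{1..N + j} = {1..q - 1} \<union> {q..<m}" "{1..q - 1} \<inter> {q..<m} = {}"
      using N by (auto simp: m_def)
    then have "(\<Prod>i=1..N + j. 1 - Var i) = C * B"
      unfolding B_def C_def by (simp add: prod.union_disjoint)
    then show ?thesis by (simp add: mult_ac)
  qed
  also have "flag.cong N \<dots> (1 * coeff F j)"
    by (intro flag.cong_mult flag.cong_refl flag_one_minus_Var) simp
  finally have "flag.cong N (B * poly (div_chain q m (F * D)) (Var m)) (coeff F j)"
    by simp
  from flag_idealD[OF this word] show ?thesis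
    by (simp only: foldr_append comp_apply eq[unfolded m_def] m_def F_def)
qed

text \<open>
  The last hypothesis ensures that the coefficients of the inserted variable obey the staircase
  bound of \<open>S\<^sub>N\<close>: variables in front of position \<open>q\<close> keep their
  index, which requires \<open>n \<le> N\<close>, whereas those behind it move down by one and
  leave room for \<open>N = n - 1\<close>.
\<close>

theorem insertion_expansion:
  assumes w: "w \<in> Sym n" and N: "n \<le> Suc N" "1 \<le> q" "q \<le> N" "n \<le> N \<or> q = 1"
  defines "c \<equiv> \<lambda>j u. struct_const w (r_perm q (N - q + 1)) (xi N q j u)"
  shows "finite {(j, u). u \<in> Sym N \<and> c j u \<noteq> 0} \<and>
    insert_var q (groth w) =
      (\<Sum>(j, u) \<in> {(j, u). u \<in> Sym N \<and> c j u \<noteq> 0}. of_int (c j u) * Y ^ j * [:groth u:])"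
proof -
  define F where "F = insert_var q (groth w)"
  define d where "d = degree F"
  have bw: "bounded_by (stair_bound n) (groth w)" by (rule stair_bound_groth[OF w])
  \<comment> \<open>Words with letters below \<open>N\<close>, as the ideal only controls operators with these indices.\<close>
  define W where "W u = (SOME is. set is \<subseteq> {1..<N} \<and> reduced_word u is)" for u
  have W: "set (W u) \<subseteq> {1..<N} \<and> reduced_word u (W u)" if "u \<in> Sym N" for u
    unfolding W_def using reduced_word_exists[OF that] by (metis (mono_tags, lifting) someI_ex)
  have c: "c j u = const_term (foldr hat (W u) (coeff F j))" if u: "u \<in> Sym N" for j u
  proof -
    have "reduced_word (xi N q j u) (W u @ rev [q..<N + j + 1])"
      using reduced_word_xi[OF u _ N(2), of "W u" j] W[OF u] N(3) by simp
    then have "c j u = const_term (foldr hat (W u @ rev [q..<N + j + 1]) (groth w * groth (r_perm q (N - q + 1))))"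
      unfolding c_def using w N by (intro struct_const_eq r_perm_Sym_inf) (auto simp: Sym_inf_iff)
    also have "\<dots> = const_term (foldr hat (W u) (coeff F j))"
      unfolding F_def using const_term_hat_insert[OF bw N(1-3)] W[OF u] by blast
    finally show ?thesis .
  qed
  have coeff: "coeff F j = (\<Sum>u\<in>Sym N. of_int (c j u) * groth u)" for j
  proof -
    have "F = shift_subst q (\<lambda>l. if l < q then l else l - 1) (groth w)"
      unfolding F_def insert_var_def shift_subst_def by (intro substitute_cong) auto
    moreover have "bounded_by (stair_bound N) (coeff (shift_subst q (\<lambda>l. if l < q then l else l - 1) (groth w)) j)"
      using N by (intro bounded_by_shift_subst[OF bw]) (auto simp: inj_on_def stair_bound_def)
    ultimately have "coeff F j = (\<Sum>u\<in>Sym N. of_int (const_term (foldr hat (W u) (coeff F j))) * groth u)"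
      using W by (intro groth_expansion) auto
    also have "\<dots> = (\<Sum>u\<in>Sym N. of_int (c j u) * groth u)" using c by (intro sum.cong) auto
    finally show ?thesis .
  qed
  define S where "S = {(j, u). u \<in> Sym N \<and> c j u \<noteq> 0}"
  have fin: "finite (Sym N)" by (simp add: Sym_def finite_permutations)
  have "c j u = 0" if "u \<in> Sym N" "d < j" for j u
    using c[OF that(1)] that(2) by (simp add: d_def coeff_eq_0)
  then have S: "S \<subseteq> {..d} \<times> Sym N" by (auto simp: S_def not_less[symmetric])
  have "F = (\<Sum>j\<le>d. monom (coeff F j) j)"
    unfolding d_def by (rule poly_as_sum_of_monoms[symmetric])
  also have "\<dots> = (\<Sum>j\<le>d. \<Sum>u\<in>Sym N. of_int (c j u) * Y ^ j * [:groth u:])"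
  proof (rule sum.cong)
    fix j
    have "of_int (c j u) * Y ^ j * [:groth u:] = monom (of_int (c j u) * groth u) j" for u
      by (simp add: Y_def monom_altdef of_int_poly mult.commute)
    then show "monom (coeff F j) j = (\<Sum>u\<in>Sym N. of_int (c j u) * Y ^ j * [:groth u:])"
      unfolding coeff by (simp add: monom_sum)
  qed simp
  also have "\<dots> = (\<Sum>(j, u)\<in>{..d} \<times> Sym N. of_int (c j u) * Y ^ j * [:groth u:])"
    by (simp add: sum.cartesian_product)
  also have "\<dots> = (\<Sum>(j, u)\<in>S. of_int (c j u) * Y ^ j * [:groth u:])"
    using fin S by (intro sum.mono_neutral_right) (auto simp: S_def)
  finally show ?thesis
    using finite_subset[OF S] fin by (simp add: F_def S_def)
qed

theorem theorem8p1:
  fixes n q :: nat and w :: "nat \<Rightarrow> nat"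
  assumes "w \<in> Sym n" and "1 \<le> q" and "q < n"
  shows
    "(finite {(j, u). u \<in> Sym n \<and> struct_const w (r_perm q (n - q + 1)) (xi n q j u) \<noteq> 0} \<and>
      insert_var q (groth w) =
        (\<Sum>(j, u) \<in> {(j, u). u \<in> Sym n \<and> struct_const w (r_perm q (n - q + 1)) (xi n q j u) \<noteq> 0}.
           of_int (struct_const w (r_perm q (n - q + 1)) (xi n q j u)) * Y ^ j * [:groth u:])) \<and>
     (q = 1 \<longrightarrow>
      finite {(j, u). u \<in> Sym (n - 1) \<and> struct_const w (r_perm 1 (n - 1)) (prepend n j u) \<noteq> 0} \<and>
      insert_var 1 (groth w) =
        (\<Sum>(j, u) \<in> {(j, u). u \<in> Sym (n - 1) \<and> struct_const w (r_perm 1 (n - 1)) (prepend n j u) \<noteq> 0}.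
           of_int (struct_const w (r_perm 1 (n - 1)) (prepend n j u)) * Y ^ j * [:groth u:]))"
proof (rule conjI[OF _ impI])
  have p: "prepend n j u = xi (n - 1) 1 j u" for j u using assms by (intro prepend_eq_xi) simp
  have r: "n - 1 - 1 + 1 = n - 1" using assms by simp
  show "finite {(j, u). u \<in> Sym (n - 1) \<and> struct_const w (r_perm 1 (n - 1)) (prepend n j u) \<noteq> 0} \<and>
      insert_var 1 (groth w) =
        (\<Sum>(j, u) \<in> {(j, u). u \<in> Sym (n - 1) \<and> struct_const w (r_perm 1 (n - 1)) (prepend n j u) \<noteq> 0}.
           of_int (struct_const w (r_perm 1 (n - 1)) (prepend n j u)) * Y ^ j * [:groth u:])"
    unfolding p using insertion_expansion[OF assms(1), of "n - 1" 1] assms unfolding r by simp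
qed (use insertion_expansion[OF assms(1), of n q] assms in simp)

end
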